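(* Let $A_n$ be the Yosida approximants of $A$, let $G(t)$ be the fundamental solution associated with $(A,F)$, and let $G_n(t)$, $n\in\mathbb{N}$, be the fundamental solutions associated with $(A_n,F)$, i.e. of the equations $dy(t)=A_ny(t)dt+Fy_t\,dt$, $t>0$. Then for any $x\in H$, $$G_n(t)x\to G(t)x\quad\text{as } n\to\infty,$$ and this convergence is uniform with respect to $t$ on any compact interval in $\mathbb{R}_+$.
   Context: $H$ is a real separable Hilbert space, $r>0$ is fixed, $A$ generates a $C_0$-semigroup $e^{tA}$, $t\ge0$, on $H$. $F:W^{1,2}([-r,0];H)\to H$ is a bounded linear operator such that, writing $y_t(\theta)=y(t+\theta)$ for $\theta\in[-r,0]$, the map $(Fy)(t)=Fy_t$ extends, for each $T\ge 0$, to a bounded linear operator $F:L^2([-r,T];H)\to L^2([0,T];H)$; that is, there is $M_2>0$ with $\int_0^T\|(Fy)(t)\|_H^2dt\le M_2\int_{-r}^T\|y(t)\|_H^2dt$ for all $y\in L^2([-r,T];H)$. Fundamental solution: for $\Phi=(\phi_0,\phi_1)\in H\times L^2([-r,0];H)$ there is a unique mild solution $y(\cdot,\Phi)$, i.e. the solution of $y(t)=e^{tA}\phi_0+\int_0^te^{(t-s)A}Fy_s\,ds$ for $t>0$, $y(0)=\phi_0$, $y(\theta)=\phi_1(\theta)$ for $\theta\in[-r,0)$. The (retarded) fundamental solution associated with $(A,F)$ is the family $G(t)\in\mathscr{L}(H)$, $t\in\mathbb{R}$, with $G(t)x=y(t,(x,0))$ for $t\ge0$, $x\in H$, and $G(t)=0$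 for $t<0$; equivalently $G(t)=e^{tA}+\int_0^te^{(t-s)A}FG(s+\cdot)ds$ for $t\ge0$. $G_n$ is defined in the same way with $A_n$ in place of $A$. Yosida approximants: $A_n=AnR(n,A)=n^2R(n,A)-nI$ for $n\in\rho(A)$, where $R(n,A)$ is the resolvent of $A$. *)

theory Defs
  imports "HOL-Analysis.Analysis"
begin

section \<open>Semigroups, generators, resolvents\<close>

definition c0_semigroup :: "(real \<Rightarrow> 'a::real_normed_vector \<Rightarrow>\<^sub>L 'a) \<Rightarrow> bool" where
  "c0_semigroup S \<longleftrightarrow>
     S 0 = id_blinfun \<and>
     (\<forall>s\<ge>0. \<forall>t\<ge>0. S (s + t) = S s o\<^sub>L S t) \<and>
     (\<forall>x. ((\<lambda>t. S t x) \<longlongrightarrow> x) (at_right 0))"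

text \<open>An unbounded operator is given by its domain \<open>D\<close> and a function \<open>A\<close> whose values
  outside \<open>D\<close> are irrelevant. Values of a semigroup at negative times are irrelevant, too.\<close>

definition generates ::
  "'a::real_normed_vector set \<Rightarrow> ('a \<Rightarrow> 'a) \<Rightarrow> (real \<Rightarrow> 'a \<Rightarrow>\<^sub>L 'a) \<Rightarrow> bool" where
  "generates D A S \<longleftrightarrow>
     c0_semigroup S \<and>
     D = {x. \<exists>z. ((\<lambda>h. (S h x - x) /\<^sub>R h) \<longlongrightarrow> z) (at_right 0)} \<and>
     (\<forall>x\<in>D. ((\<lambda>h. (S h x - x) /\<^sub>R h) \<longlongrightarrow> A x) (at_right 0))"

definition resolvent_set :: "'a::real_normed_vector set \<Rightarrow> ('a \<Rightarrow> 'a) \<Rightarrow> real set" where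
  "resolvent_set D A =
     {l. bij_betw (\<lambda>x. l *\<^sub>R x - A x) D UNIV \<and>
         bounded_linear (inv_into D (\<lambda>x. l *\<^sub>R x - A x))}"

text \<open>Meaningful only for \<open>l\<close> in the resolvent set.\<close>

definition resolvent ::
  "'a::real_normed_vector set \<Rightarrow> ('a \<Rightarrow> 'a) \<Rightarrow> real \<Rightarrow> 'a \<Rightarrow>\<^sub>L 'a" where
  "resolvent D A l = Blinfun (inv_into D (\<lambda>x. l *\<^sub>R x - A x))"

definition yosida ::
  "'a::real_normed_vector set \<Rightarrow> ('a \<Rightarrow> 'a) \<Rightarrow> nat \<Rightarrow> 'a \<Rightarrow>\<^sub>L 'a" where
  "yosida D A n = (real n)\<^sup>2 *\<^sub>R resolvent D A (real n) - real n *\<^sub>R id_blinfun"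

lemma yosida_apply:
  assumes "real n \<in> resolvent_set D A"
  shows "yosida D A n x = real n *\<^sub>R A (resolvent D A (real n) x)"
proof -
  let ?f = "\<lambda>x. real n *\<^sub>R x - A x"
  have R: "resolvent D A (real n) x = inv_into D ?f x"
    using assms by (simp add: resolvent_def resolvent_set_def bounded_linear_Blinfun_apply)
  have "?f (inv_into D ?f x) = x"
    using assms by (auto simp: resolvent_set_def bij_betw_def intro!: f_inv_into_f)
  then have "A (resolvent D A (real n) x) = real n *\<^sub>R resolvent D A (real n) x - x"
    unfolding R by (simp add: algebra_simps)
  then show ?thesis
    by (simp add: yosida_def blinfun.bilinear_simps scaleR_diff_right power2_eq_square)
qed


section \<open>Vector-valued \<open>L\<^sup>2\<close> and \<open>W\<^sup>1\<^sup>,\<^sup>2\<close> on compact intervals\<close>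

text \<open>Elements of both spaces are represented by total functions, of which only the restriction
  to \<open>[a,b]\<close>, up to null sets, matters.\<close>

definition L2_on ::
  "real \<Rightarrow> real \<Rightarrow> (real \<Rightarrow> 'a::{real_normed_vector, second_countable_topology}) \<Rightarrow> bool" where
  "L2_on a b f \<longleftrightarrow>
     f \<in> borel_measurable (lebesgue_on {a..b}) \<and>
     integrable (lebesgue_on {a..b}) (\<lambda>t. (norm (f t))\<^sup>2)"

definition test_function :: "real \<Rightarrow> real \<Rightarrow> (real \<Rightarrow> real) \<Rightarrow> bool" where
  "test_function a b u \<longleftrightarrow>
     (\<forall>k t. (deriv ^^ k) u differentiable (at t)) \<and>
     (\<exists>c d. a < c \<and> d < b \<and> (\<forall>t. t \<notin> {c..d} \<longrightarrow> u t = 0))"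

definition weak_deriv ::
  "real \<Rightarrow> real \<Rightarrow> (real \<Rightarrow> 'a::{banach, second_countable_topology}) \<Rightarrow> (real \<Rightarrow> 'a) \<Rightarrow> bool" where
  "weak_deriv a b y g \<longleftrightarrow>
     (\<forall>u. test_function a b u \<longrightarrow>
        (LINT t|lebesgue_on {a..b}. deriv u t *\<^sub>R y t)
          = - (LINT t|lebesgue_on {a..b}. u t *\<^sub>R g t))"

definition W12 :: "real \<Rightarrow> real \<Rightarrow> (real \<Rightarrow> 'a::{banach, second_countable_topology}) \<Rightarrow> bool" where
  "W12 a b y \<longleftrightarrow> L2_on a b y \<and> (\<exists>g. L2_on a b g \<and> weak_deriv a b y g)"

text \<open>Linearity together with the norm bound forces \<open>F\<close> to identify functions agreeing almost
  everywhere on \<open>[a,b]\<close>, so \<open>F\<close> descends to equivalence classes.\<close>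

definition W12_bounded_linear ::
  "real \<Rightarrow> real \<Rightarrow> ((real \<Rightarrow> 'a::{banach, second_countable_topology}) \<Rightarrow> 'a) \<Rightarrow> bool" where
  "W12_bounded_linear a b F \<longleftrightarrow>
     (\<forall>y z. W12 a b y \<longrightarrow> W12 a b z \<longrightarrow> F (\<lambda>t. y t + z t) = F y + F z) \<and>
     (\<forall>c y. W12 a b y \<longrightarrow> F (\<lambda>t. c *\<^sub>R y t) = c *\<^sub>R F y) \<and>
     (\<exists>C. \<forall>y g. L2_on a b y \<longrightarrow> L2_on a b g \<longrightarrow> weak_deriv a b y g \<longrightarrow>
        norm (F y) \<le> C * sqrt ((LINT t|lebesgue_on {a..b}. (norm (y t))\<^sup>2)
                              + (LINT t|lebesgue_on {a..b}. (norm (g t))\<^sup>2)))"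


section \<open>The delay operator and retarded equations\<close>

text \<open>\<open>E\<close> is a bounded linear operator from \<open>L\<^sup>2([-r,T])\<close> to \<open>L\<^sup>2([0,T])\<close> (acting on
  representatives) that extends \<open>y \<mapsto> (t \<mapsto> F y\<^sub>t)\<close>, where \<open>y\<^sub>t \<theta> = y (t + \<theta>)\<close>.\<close>

definition delay_extension ::
  "real \<Rightarrow> real \<Rightarrow> ((real \<Rightarrow> 'a::{banach, second_countable_topology}) \<Rightarrow> 'a)
     \<Rightarrow> ((real \<Rightarrow> 'a) \<Rightarrow> real \<Rightarrow> 'a) \<Rightarrow> bool" where
  "delay_extension r T F E \<longleftrightarrow>
     (\<forall>y. L2_on (-r) T y \<longrightarrow> L2_on 0 T (E y)) \<and>
     (\<forall>y z. L2_on (-r) T y \<longrightarrow> L2_on (-r) T z \<longrightarrow>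
        (AE t in lebesgue_on {0..T}. E (\<lambda>s. y s + z s) t = E y t + E z t)) \<and>
     (\<forall>c y. L2_on (-r) T y \<longrightarrow>
        (AE t in lebesgue_on {0..T}. E (\<lambda>s. c *\<^sub>R y s) t = c *\<^sub>R E y t)) \<and>
     (\<exists>M>0. \<forall>y. L2_on (-r) T y \<longrightarrow>
        (LINT t|lebesgue_on {0..T}. (norm (E y t))\<^sup>2)
          \<le> M * (LINT t|lebesgue_on {-r..T}. (norm (y t))\<^sup>2)) \<and>
     (\<forall>y. W12 (-r) T y \<longrightarrow>
        (AE t in lebesgue_on {0..T}. E y t = F (\<lambda>\<theta>. y (t + \<theta>))))"

text \<open>\<open>E T\<close> is the extended delay operator for the time horizon \<open>T\<close>, so the integrand below is
  \<open>S (t - s) (F y\<^sub>s)\<close>.\<close>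

definition mild_solution ::
  "real \<Rightarrow> (real \<Rightarrow> 'a::{banach, second_countable_topology} \<Rightarrow>\<^sub>L 'a)
     \<Rightarrow> (real \<Rightarrow> (real \<Rightarrow> 'a) \<Rightarrow> real \<Rightarrow> 'a) \<Rightarrow> 'a \<Rightarrow> (real \<Rightarrow> 'a) \<Rightarrow> (real \<Rightarrow> 'a) \<Rightarrow> bool" where
  "mild_solution r S E x0 x1 y \<longleftrightarrow>
     y 0 = x0 \<and>
     (\<forall>\<theta>\<in>{-r..<0}. y \<theta> = x1 \<theta>) \<and>
     (\<forall>T\<ge>0. L2_on (-r) T y \<and>
        (\<forall>t\<in>{0<..T}. y t = S t x0 + (LINT s|lebesgue_on {0..t}. S (t - s) (E T y s))))"

definition fundamental_solution ::
  "real \<Rightarrow> 'a::{banach, second_countable_topology} set \<Rightarrow> ('a \<Rightarrow> 'a)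
     \<Rightarrow> (real \<Rightarrow> (real \<Rightarrow> 'a) \<Rightarrow> real \<Rightarrow> 'a) \<Rightarrow> (real \<Rightarrow> 'a \<Rightarrow>\<^sub>L 'a) \<Rightarrow> bool" where
  "fundamental_solution r D A E G \<longleftrightarrow>
     (\<forall>t<0. G t = 0) \<and>
     (\<exists>S. generates D A S \<and> (\<forall>x. mild_solution r S E x (\<lambda>_. 0) (\<lambda>t. G t x)))"

end

theory Submission imports Defs begin

text \<open>
  Write \<open>S\<close> for the semigroup generated by \<open>A\<close>, \<open>S\<^sub>n\<close> for the one generated by the Yosida
  approximant \<open>A\<^sub>n\<close>, and \<open>y\<close>, \<open>y\<^sub>n\<close> for the orbits of \<open>x\<close> under the fundamental solutions \<open>G\<close>, \<open>G\<^sub>n\<close>.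
  Subtracting the two integral equations gives
  \<open>y\<^sub>n(t) - y(t) = d\<^sub>n(t) + \<integral>\<^sub>0\<^sup>t S\<^sub>n(t - s) F(y\<^sub>n - y)(s) ds\<close> with the defect
  \<open>d\<^sub>n(t) = S\<^sub>n(t) x - S(t) x + \<integral>\<^sub>0\<^sup>t (S\<^sub>n - S)(t - s) (F y)(s) ds\<close>. The theorem follows once three
  things are known: the \<open>S\<^sub>n\<close> are bounded on \<open>[0,T]\<close> independently of \<open>n\<close>, the defect tends to \<open>0\<close>
  uniformly on \<open>[0,T]\<close>, and the square norm of \<open>F(z)\<close> over \<open>[0,t]\<close> is bounded by a constant times
  that of \<open>z\<close> over \<open>[-r,t]\<close> with a constant independent of \<open>t\<close>; a Gronwall argument
  (\<open>mild_solution_perturbation\<close>) combines them.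

  The first two points are the Trotter-Kato theorem for Yosida approximants. The resolvent is
  identified with the Laplace transform of \<open>S\<close> (\<open>resolvent_eq_laplace\<close>). An equivalent norm in which
  \<open>S\<close> has growth constant \<open>1\<close> makes the resolvent bound stable under powers, and Euler's formula
  expresses \<open>S\<^sub>n\<close> through powers of operators built from the resolvent; together they give the uniform
  bound (\<open>yosida_semigroup_bound\<close>). Convergence on the domain of \<open>A\<close> comes from telescoping
  \<open>S\<^sub>n(t/m)\<^sup>m - S(t/m)\<^sup>m\<close> (\<open>yosida_semigroup_diff\<close>) and extends by density
  (\<open>yosida_semigroups_converge\<close>); for the integral term of the defect one adds dominated convergence
  (\<open>yosida_convolutions_converge\<close>).

  The third point is a causality statement: the extended delay operator for the horizon \<open>T\<close> must not
  see the future. This holds because it acts by segments on Sobolev functions and because backward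
  averages approximate continuous functions by Sobolev functions without moving their support
  into the past (\<open>delay_extension_causal\<close>, \<open>delay_extension_integral_le_past\<close>).
\<close>

section \<open>Growth bounds and joint continuity of semigroups\<close>

text \<open>The sets on which all \<open>T i\<close> are bounded by \<open>n\<close> are closed and cover the space, so by Baire one
  of them contains a ball; differences of points of that ball reach every direction.\<close>

lemma uniform_boundedness:
  fixes T :: "'i \<Rightarrow> 'a::banach \<Rightarrow>\<^sub>L 'b::real_normed_vector"
  assumes "\<And>x. \<exists>c. \<forall>i\<in>I. norm (T i x) \<le> c"
  shows "\<exists>K. \<forall>i\<in>I. norm (T i) \<le> K"
proof -
  define B where "B n = {x. \<forall>i\<in>I. norm (T i x) \<le> real n}" for n
  have cl: "closed (B n)" for n
  proof -
    have "B n = (\<Inter>i\<in>I. {x. norm (T i x) \<le> real n})" by (auto simp: B_def)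
    moreover have "closed {x. norm (T i x) \<le> real n}" for i
      by (intro closed_Collect_le continuous_intros)
    ultimately show ?thesis by auto
  qed
  have cover: "(\<Union>n. B n) = UNIV"
  proof -
    have "\<exists>n. x \<in> B n" for x
    proof -
      obtain c where c: "\<forall>i\<in>I. norm (T i x) \<le> c" using assms by blast
      obtain n where "c \<le> real n" using real_arch_simple by blast
      then have "x \<in> B n" using c by (fastforce simp: B_def)
      then show ?thesis ..
    qed
    then show ?thesis by blast
  qed
  have "\<exists>n. interior (B n) \<noteq> {}"
  proof (rule ccontr)
    assume "\<not> ?thesis"
    then have *: "euclidean interior_of \<Union>(range B) = ({} :: 'a set)"
      by (intro Baire_category_alt) (auto simp: cl completely_metrizable_space_euclidean)
    then show False by (simp add: cover)
  qed
  then obtain n x0 e where e: "e > 0" "ball x0 e \<subseteq> B n"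
    by (metis ex_in_conv mem_interior)
  have "norm (T i v) \<le> 4 * real n / e * norm v" if i: "i \<in> I" for i v
  proof (cases "v = 0")
    case False
    define c where "c = e / (2 * norm v)"
    have c: "c > 0" using e False by (simp add: c_def)
    have "norm (c *\<^sub>R v) < e" using e False c by (simp add: c_def)
    then have "x0 + c *\<^sub>R v \<in> B n" "x0 \<in> B n"
      using e by (auto intro!: subsetD[OF e(2)] simp: dist_norm)
    then have "norm (T i (x0 + c *\<^sub>R v)) \<le> n" "norm (T i x0) \<le> n" using i by (auto simp: B_def)
    then have "norm (T i (x0 + c *\<^sub>R v) - T i x0) \<le> 2 * real n"
      using norm_triangle_ineq4[of "T i (x0 + c *\<^sub>R v)" "T i x0"] by linarith
    moreover have "c *\<^sub>R T i v = T i (x0 + c *\<^sub>R v) - T i x0"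
      by (simp add: blinfun.bilinear_simps)
    ultimately have "norm (c *\<^sub>R T i v) \<le> 2 * real n"
      by simp
    then have "c * norm (T i v) \<le> 2 * real n" using c by simp
    then show ?thesis using e False c by (simp add: c_def field_simps)
  qed simp
  then show ?thesis using e
    by (intro exI[of _ "4 * real n / e"] ballI norm_blinfun_bound) auto
qed

lemma c0_semigroup_zero: "c0_semigroup S \<Longrightarrow> S 0 x = x"
  by (simp add: c0_semigroup_def)

lemma c0_semigroup_add: "c0_semigroup S \<Longrightarrow> s \<ge> 0 \<Longrightarrow> t \<ge> 0 \<Longrightarrow> S (s + t) x = S s (S t x)"
  by (simp add: c0_semigroup_def)

lemma c0_semigroup_commute: "c0_semigroup S \<Longrightarrow> s \<ge> 0 \<Longrightarrow> t \<ge> 0 \<Longrightarrow> S s (S t x) = S t (S s x)"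
  by (metis c0_semigroup_add add.commute)

lemma c0_semigroup_tendsto: "c0_semigroup S \<Longrightarrow> ((\<lambda>t. S t x) \<longlongrightarrow> x) (at_right 0)"
  by (simp add: c0_semigroup_def)

text \<open>Otherwise there are times \<open>\<tau> n\<close> tending to \<open>0\<close> with \<open>norm (S (\<tau> n))\<close> unbounded, although
  every orbit \<open>S (\<tau> n) x\<close> converges; this contradicts uniform boundedness.\<close>

lemma c0_semigroup_locally_bounded:
  fixes S :: "real \<Rightarrow> 'a::banach \<Rightarrow>\<^sub>L 'a"
  assumes S: "c0_semigroup S"
  shows "\<exists>\<delta>>0. \<exists>K. \<forall>t\<in>{0..\<delta>}. norm (S t) \<le> K"
proof (rule ccontr)
  assume "\<not> ?thesis"
  then have *: "\<And>\<delta> K. \<delta> > 0 \<Longrightarrow> \<exists>t. 0 \<le> t \<and> t \<le> \<delta> \<and> norm (S t) > K"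
    by (metis atLeastAtMost_iff not_le)
  have "\<forall>n. \<exists>t. 0 \<le> t \<and> t \<le> inverse (real (Suc n)) \<and> norm (S t) > real n + norm (S 0)"
    by (intro allI *) auto
  then obtain \<tau> where \<tau>: "\<And>n. 0 \<le> \<tau> n" "\<And>n. \<tau> n \<le> inverse (real (Suc n))"
      "\<And>n. norm (S (\<tau> n)) > real n + norm (S 0)"
    by metis
  have pos: "\<tau> n > 0" for n
    using \<tau>(1,3)[of n] by (cases "\<tau> n = 0") auto
  have "\<tau> \<longlonglongrightarrow> 0"
    by (rule tendsto_sandwich[OF _ _ tendsto_const LIMSEQ_inverse_real_of_nat]) (use \<tau> in auto)
  then have lim: "filterlim \<tau> (at_right 0) sequentially"
    by (auto simp: filterlim_at pos less_imp_neq[OF pos, symmetric])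
  have "\<exists>c. \<forall>n\<in>UNIV. norm (S (\<tau> n) x) \<le> c" for x
  proof -
    have "(\<lambda>n. S (\<tau> n) x) \<longlonglongrightarrow> x"
      using filterlim_compose[OF c0_semigroup_tendsto[OF S] lim] .
    then have "Bseq (\<lambda>n. S (\<tau> n) x)" by (rule convergent_imp_Bseq[OF convergentI])
    then show ?thesis by (auto simp: Bseq_def)
  qed
  then obtain K where K: "\<And>n. norm (S (\<tau> n)) \<le> K"
    using uniform_boundedness[of UNIV "\<lambda>n. S (\<tau> n)"] by auto
  obtain n where "K \<le> real n" using real_arch_simple by blast
  then show False using K[of n] \<tau>(3)[of n] norm_ge_zero[of "S 0"] by linarith
qed

text \<open>The semigroup law propagates the bound on \<open>[0,\<delta>]\<close>: reaching time \<open>t\<close> takes about \<open>t / \<delta>\<close> factors.\<close>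

lemma c0_semigroup_exponential_bound:
  fixes S :: "real \<Rightarrow> 'a::banach \<Rightarrow>\<^sub>L 'a"
  assumes S: "c0_semigroup S"
  obtains M \<omega> where "M \<ge> 1" "\<omega> \<ge> 0" "\<And>t. t \<ge> 0 \<Longrightarrow> norm (S t) \<le> M * exp (\<omega> * t)"
proof -
  obtain \<delta> K where \<delta>: "\<delta> > 0" and K: "\<And>t. 0 \<le> t \<Longrightarrow> t \<le> \<delta> \<Longrightarrow> norm (S t) \<le> K"
    using c0_semigroup_locally_bounded[OF S] by (metis atLeastAtMost_iff)
  define M where "M = max K 1"
  have M: "M \<ge> 1" "\<And>t. 0 \<le> t \<Longrightarrow> t \<le> \<delta> \<Longrightarrow> norm (S t) \<le> M"
    using K by (force simp: M_def)+
  have pw: "norm (S (real k * \<delta> + s)) \<le> M ^ Suc k" if "0 \<le> s" "s \<le> \<delta>" for k s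
  proof (induction k)
    case 0 then show ?case using M(2)[OF that] by simp
  next
    case (Suc k)
    have "S (\<delta> + (real k * \<delta> + s)) = S \<delta> o\<^sub>L S (real k * \<delta> + s)"
      using S \<delta> that by (simp add: c0_semigroup_def)
    moreover have "\<delta> + (real k * \<delta> + s) = real (Suc k) * \<delta> + s"
      by (simp add: algebra_simps)
    ultimately have "S (real (Suc k) * \<delta> + s) = S \<delta> o\<^sub>L S (real k * \<delta> + s)"
      by metis
    then have "norm (S (real (Suc k) * \<delta> + s)) \<le> norm (S \<delta>) * norm (S (real k * \<delta> + s))"
      by (simp add: norm_blinfun_compose)
    also have "\<dots> \<le> M * M ^ Suc k"
      using M \<delta> Suc.IH by (intro mult_mono) auto
    finally show ?case by simp
  qed
  have "norm (S t) \<le> M * exp (ln M / \<delta> * t)" if t: "t \<ge> 0" for t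
  proof -
    define k where "k = nat \<lfloor>t / \<delta>\<rfloor>"
    have fl: "real k \<le> t / \<delta>" "t / \<delta> < real k + 1"
      using t \<delta> by (auto simp: k_def of_nat_nat)
    have "0 \<le> t - real k * \<delta>" "t - real k * \<delta> \<le> \<delta>"
      using fl \<delta> by (auto simp: field_simps)
    from pw[OF this, of k] have "norm (S t) \<le> M * M ^ k" by simp
    also have "M ^ k = exp (real k * ln M)"
      using M(1) by (simp add: exp_of_nat_mult)
    also have "\<dots> \<le> exp (t / \<delta> * ln M)"
      using mult_right_mono[OF fl(1), of "ln M"] M(1) by simp
    finally show ?thesis using M(1) by (simp add: mult_left_mono mult.commute)
  qed
  then show thesis using M(1) \<delta> by (intro that[of M "ln M / \<delta>"]) auto
qed

text \<open>The growth constants are parameters because the estimates for the Yosida approximants are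
  stated in terms of the constants of the original semigroup. The sign condition on \<open>\<omega>\<close> loses no
  generality and makes all bounds monotone in time.\<close>

locale exp_bounded_semigroup =
  fixes S :: "real \<Rightarrow> 'a::{banach, second_countable_topology} \<Rightarrow>\<^sub>L 'a" and M \<omega> :: real
  assumes c0: "c0_semigroup S"
    and M_ge_1: "M \<ge> 1" and \<omega>_nonneg: "\<omega> \<ge> 0"
    and norm_bound: "\<And>t. t \<ge> 0 \<Longrightarrow> norm (S t) \<le> M * exp (\<omega> * t)"
begin

lemma norm_apply_bound: "t \<ge> 0 \<Longrightarrow> norm (S t x) \<le> M * exp (\<omega> * t) * norm x"
  by (meson mult_right_mono norm_blinfun norm_bound norm_ge_zero order_trans)

lemma norm_apply_bound_upto:
  assumes "0 \<le> t" "t \<le> T"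
  shows "norm (S t x) \<le> M * exp (\<omega> * T) * norm x"
proof -
  have "M * exp (\<omega> * t) \<le> M * exp (\<omega> * T)"
    using assms M_ge_1 \<omega>_nonneg by (simp add: mult_left_mono)
  then show ?thesis
    using norm_apply_bound[of t x] assms by (meson mult_right_mono norm_ge_zero order_trans)
qed

lemma orbit_uniform_at_0:
  assumes "e > 0"
  shows "\<exists>d>0. \<forall>h. 0 \<le> h \<and> h < d \<longrightarrow> norm (S h x - x) < e"
proof -
  have "\<forall>\<^sub>F h in at_right 0. dist (S h x) x < e"
    using c0_semigroup_tendsto[OF c0] assms by (rule tendstoD)
  then obtain d where "d > 0" "\<And>h. 0 < h \<Longrightarrow> h < d \<Longrightarrow> dist (S h x) x < e"
    unfolding eventually_at_right_field by auto
  then show ?thesis using assms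
    by (intro exI[of _ d]) (auto simp: dist_norm c0_semigroup_zero[OF c0] le_less)
qed

text \<open>Joint continuity in time and space is what makes \<open>s \<mapsto> S (t - s) (f s)\<close> measurable for a merely
  measurable \<open>f\<close>. Values at negative times are arbitrary, so time is clamped at \<open>0\<close>; this gives
  functions that are continuous, hence measurable, on the whole space.\<close>

lemma continuous_on_clamped:
  "continuous_on UNIV (\<lambda>(t, x). S (max 0 t) x)"
proof -
  have main: "\<exists>d>0. \<forall>s y. s \<ge> 0 \<longrightarrow> \<bar>s - t\<bar> < d \<longrightarrow> norm (y - x) < d \<longrightarrow> norm (S s y - S t x) < e"
    if t: "t \<ge> 0" and e: "e > 0" for t x e
  proof -
    define C where "C = M * exp (\<omega> * (t + 1))"
    have C: "C > 0" using M_ge_1 by (simp add: C_def)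
    obtain d where d: "d > 0" "\<And>h. 0 \<le> h \<Longrightarrow> h < d \<Longrightarrow> norm (S h x - x) < e / (2 * C)"
      using orbit_uniform_at_0[of "e / (2 * C)" x] e C by auto
    have "norm (S s y - S t x) < e"
      if s: "s \<ge> 0" "\<bar>s - t\<bar> < min d (min 1 (e / (2 * C)))" "norm (y - x) < min d (min 1 (e / (2 * C)))" for s y
    proof -
      have "norm (S s y - S s x) \<le> C * norm (y - x)"
        using norm_apply_bound_upto[of s "t + 1" "y - x"] s(1) abs_le_D1[of "s - t" 1] s(2)
        by (simp add: C_def blinfun.diff_right)
      also have "\<dots> < C * (e / (2 * C))" using s C by (intro mult_strict_left_mono) auto
      finally have 1: "norm (S s y - S s x) < e / 2" using C by simp
      define m where "m = min s t"
      have "norm (S s x - S t x) = norm (S m (S \<bar>s - t\<bar> x - x))"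
      proof (cases "s \<le> t")
        case True
        then have "S t x = S s (S \<bar>s - t\<bar> x)" using c0_semigroup_add[OF c0, of s "t - s" x] s by simp
        then show ?thesis using True by (simp add: m_def blinfun.diff_right norm_minus_commute)
      next
        case False
        then have "S s x = S t (S \<bar>s - t\<bar> x)" using c0_semigroup_add[OF c0, of t "s - t" x] t by simp
        then show ?thesis using False by (simp add: m_def blinfun.diff_right)
      qed
      also have "\<dots> \<le> C * norm (S \<bar>s - t\<bar> x - x)"
        unfolding C_def by (rule norm_apply_bound_upto) (use s t in \<open>auto simp: m_def\<close>)
      also have "\<dots> < C * (e / (2 * C))" using s C d by (intro mult_strict_left_mono) auto
      finally have "norm (S s x - S t x) < e / 2" using C by simp
      with 1 show ?thesis
        using norm_diff_triangle_less[of "S s y" "S s x" "e / 2" "S t x" "e / 2"] by simp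
    qed
    then show ?thesis using d e C by (intro exI[of _ "min d (min 1 (e / (2 * C)))"]) auto
  qed
  show ?thesis
    unfolding continuous_on_iff
  proof (intro ballI allI impI)
    fix p :: "real \<times> 'a" and e :: real assume e: "e > 0"
    obtain t x where p: "p = (t, x)" by force
    obtain d where d: "d > 0" "\<And>s y. s \<ge> 0 \<Longrightarrow> \<bar>s - max 0 t\<bar> < d \<Longrightarrow> norm (y - x) < d \<Longrightarrow>
        norm (S s y - S (max 0 t) x) < e"
      using main[of "max 0 t" e x] e by auto
    show "\<exists>d>0. \<forall>q\<in>UNIV. dist q p < d \<longrightarrow>
        dist (case q of (t, x) \<Rightarrow> S (max 0 t) x) (case p of (t, x) \<Rightarrow> S (max 0 t) x) < e"
    proof (intro exI[of _ d] conjI ballI impI d(1))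
      fix q assume q: "dist q p < d"
      obtain s y where qs: "q = (s, y)" by force
      have "dist s t \<le> dist q p" "dist y x \<le> dist q p"
        using dist_fst_le[of q p] dist_snd_le[of q p] by (auto simp: qs p)
      then have "\<bar>max 0 s - max 0 t\<bar> < d" "norm (y - x) < d"
        using q by (auto simp: dist_norm)
      then show "dist (case q of (t, x) \<Rightarrow> S (max 0 t) x) (case p of (t, x) \<Rightarrow> S (max 0 t) x) < e"
        using d(2)[of "max 0 s" y] by (simp add: qs p dist_norm)
    qed
  qed
qed

lemma continuous_on_clamped_compose:
  assumes "continuous_on X f" "continuous_on X g"
  shows "continuous_on X (\<lambda>z. S (max 0 (f z)) (g z))"
  using continuous_on_compose2[OF continuous_on_clamped, of X "\<lambda>z. (f z, g z)"] assms
  by (simp add: continuous_on_Pair)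

lemma continuous_on_orbit: "continuous_on {0..} (\<lambda>t. S t x)"
proof -
  have "continuous_on {0..} (\<lambda>t. S (max 0 t) x)"
    by (intro continuous_on_clamped_compose continuous_intros)
  then show ?thesis by (rule continuous_on_eq) auto
qed

lemma borel_measurable_clamped [measurable (raw)]:
  assumes "f \<in> borel_measurable N" "g \<in> borel_measurable N"
  shows "(\<lambda>z. S (max 0 (f z)) (g z)) \<in> borel_measurable N"
  using borel_measurable_continuous_on[OF continuous_on_clamped, of "\<lambda>z. (f z, g z)" N] assms
  by simp

end


section \<open>Resolvent, Laplace transform and equivalent norm\<close>

lemma has_bochner_integral_exp_decay:
  fixes a :: real
  assumes "a > 0"
  shows "has_bochner_integral lborel (\<lambda>s. indicator {0..} s * exp (- (a * s))) (1 / a)"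
proof (rule has_bochner_integral_nn_integral)
  have "(\<integral>\<^sup>+x. ennreal (exp (- (a * x))) * indicator {0..} x \<partial>lborel)
      = ennreal (0 - (- exp (- (a * 0)) / a))"
  proof (rule nn_integral_FTC_atLeast)
    show "((\<lambda>x. - exp (- (a * x)) / a) \<longlongrightarrow> 0) at_top"
      using assms by real_asymp
  qed (use assms in \<open>auto intro!: derivative_eq_intros\<close>)
  then show "(\<integral>\<^sup>+x. ennreal (indicator {0..} x * exp (- (a * x))) \<partial>lborel) = ennreal (1 / a)"
    by (simp add: ennreal_mult' ennreal_indicator mult.commute)
qed (use assms in auto)

lemma integrable_exp_decay:
  "(a::real) > 0 \<Longrightarrow> integrable lborel (\<lambda>s. indicator {0..} s * exp (- (a * s)))"
  using has_bochner_integral_exp_decay by (auto simp: has_bochner_integral_iff)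

lemma integral_exp_decay:
  "(a::real) > 0 \<Longrightarrow> (LINT s|lborel. indicator {0..} s * exp (- (a * s))) = 1 / a"
  using has_bochner_integral_exp_decay by (auto simp: has_bochner_integral_iff)

lemma generates_domainD:
  "generates D A S \<Longrightarrow> x \<in> D \<Longrightarrow> ((\<lambda>h. (S h x - x) /\<^sub>R h) \<longlongrightarrow> A x) (at_right 0)"
  by (simp add: generates_def)

lemma generates_domainI:
  assumes "generates D A S" "((\<lambda>h. (S h x - x) /\<^sub>R h) \<longlongrightarrow> z) (at_right 0)"
  shows "x \<in> D" "A x = z"
proof -
  show x: "x \<in> D" using assms by (auto simp: generates_def)
  show "A x = z"
    using tendsto_unique[OF _ generates_domainD[OF assms(1) x] assms(2)] by simp
qed

context exp_bounded_semigroup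
begin

text \<open>The resolvent is the Laplace transform of the semigroup, \<open>R(l) x = \<integral>\<^sub>0\<^sup>\<infinity> exp (-l s) S(s) x ds\<close>. The
  indicator makes it an integral over the whole line, on which the measure is translation
  invariant.\<close>

definition laplace_kernel :: "real \<Rightarrow> 'a \<Rightarrow> real \<Rightarrow> 'a" where
  "laplace_kernel l x s = indicator {0..} s *\<^sub>R (exp (- (l * s)) *\<^sub>R S (max 0 s) x)"

definition laplace :: "real \<Rightarrow> 'a \<Rightarrow> 'a" where
  "laplace l x = (LINT s|lborel. laplace_kernel l x s)"

lemma laplace_kernel_measurable [measurable]: "laplace_kernel l x \<in> borel_measurable borel"
  unfolding laplace_kernel_def by measurable

lemma norm_laplace_kernel:
  "norm (laplace_kernel l x s) \<le> (M * norm x) * (indicator {0..} s * exp (- ((l - \<omega>) * s)))"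
proof (cases "s \<ge> 0")
  case True
  have "norm (laplace_kernel l x s) = exp (- (l * s)) * norm (S s x)"
    using True by (simp add: laplace_kernel_def)
  also have "\<dots> \<le> exp (- (l * s)) * (M * exp (\<omega> * s) * norm x)"
    by (intro mult_left_mono norm_apply_bound True) auto
  also have "\<dots> = M * norm x * (exp (- (l * s)) * exp (\<omega> * s))" by simp
  also have "exp (- (l * s)) * exp (\<omega> * s) = exp (- ((l - \<omega>) * s))"
    by (simp add: algebra_simps flip: exp_add)
  finally show ?thesis using True by simp
qed (simp add: laplace_kernel_def)

lemma integrable_laplace_kernel:
  assumes "l > \<omega>" shows "integrable lborel (laplace_kernel l x)"
proof (rule Bochner_Integration.integrable_bound)
  show "integrable lborel (\<lambda>s. (M * norm x) * (indicator {0..} s * exp (- ((l - \<omega>) * s))))"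
    using assms by (intro integrable_mult_right integrable_exp_decay) auto
  show "AE s in lborel. norm (laplace_kernel l x s)
      \<le> norm (M * norm x * (indicator {0..} s * exp (- ((l - \<omega>) * s))))"
    using norm_laplace_kernel M_ge_1 by (intro AE_I2) (simp add: abs_mult)
qed simp

lemma bounded_linear_laplace:
  assumes l: "l > \<omega>" shows "bounded_linear (laplace l)"
proof (rule bounded_linear_intro)
  show "laplace l (x + y) = laplace l x + laplace l y" for x y
    unfolding laplace_def
    by (subst Bochner_Integration.integral_add[symmetric])
       (auto simp: integrable_laplace_kernel[OF l] laplace_kernel_def blinfun.add_right
          scaleR_add_right intro!: Bochner_Integration.integral_cong)
  show "laplace l (c *\<^sub>R x) = c *\<^sub>R laplace l x" for c x
    unfolding laplace_def
    by (subst integral_scaleR_right[symmetric])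
       (auto simp: integrable_laplace_kernel[OF l] laplace_kernel_def blinfun.scaleR_right
          intro!: Bochner_Integration.integral_cong)
  show "norm (laplace l x) \<le> norm x * (M * (1 / (l - \<omega>)))" for x
  proof -
    have "norm (laplace l x) \<le> (LINT s|lborel. (M * norm x) * (indicator {0..} s * exp (- ((l - \<omega>) * s))))"
      unfolding laplace_def using l
      by (intro Bochner_Integration.integral_norm_bound_integral integrable_laplace_kernel norm_laplace_kernel
          integrable_mult_right integrable_exp_decay) auto
    also have "\<dots> = M * norm x * (1 / (l - \<omega>))"
      using l integral_exp_decay[of "l - \<omega>"] by simp
    finally show ?thesis by (simp add: mult_ac)
  qed
qed

lemma laplace_commute:
  assumes l: "l > \<omega>" and t: "t \<ge> 0"
  shows "S t (laplace l x) = laplace l (S t x)"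
proof -
  have "S t (laplace l x) = (LINT s|lborel. S t (laplace_kernel l x s))"
    unfolding laplace_def
    by (rule integral_bounded_linear[symmetric, OF blinfun.bounded_linear_right
          integrable_laplace_kernel[OF l]])
  also have "\<dots> = laplace l (S t x)"
    unfolding laplace_def laplace_kernel_def
    by (intro Bochner_Integration.integral_cong refl)
       (simp add: blinfun.scaleR_right c0_semigroup_commute[OF c0 t])
  finally show ?thesis .
qed

text \<open>Applying \<open>S h\<close> translates the kernel by \<open>h\<close>; the part of the integral that drops out is the one
  over \<open>[0,h)\<close>.\<close>

lemma laplace_shift:
  assumes l: "l > \<omega>" and h: "h \<ge> 0"
  shows "S h (laplace l x) = exp (l * h) *\<^sub>R
    (laplace l x - (LINT s|lborel. indicator {0..<h} s *\<^sub>R laplace_kernel l x s))"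
proof -
  have "S h (laplace l x) = (LINT s|lborel. S h (laplace_kernel l x s))"
    unfolding laplace_def
    by (rule integral_bounded_linear[symmetric, OF blinfun.bounded_linear_right
          integrable_laplace_kernel[OF l]])
  also have "\<dots> = (LINT s|lborel. exp (l * h) *\<^sub>R
      (laplace_kernel l x (h + 1 * s) - indicator {0..<h} (h + 1 * s) *\<^sub>R laplace_kernel l x (h + 1 * s)))"
  proof (intro Bochner_Integration.integral_cong refl)
    fix s :: real
    show "S h (laplace_kernel l x s) = exp (l * h) *\<^sub>R
      (laplace_kernel l x (h + 1 * s) - indicator {0..<h} (h + 1 * s) *\<^sub>R laplace_kernel l x (h + 1 * s))"
    proof (cases "s \<ge> 0")
      case True
      have e: "exp (- (l * s)) = exp (l * h) * exp (- (l * (h + s)))"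
        by (simp add: algebra_simps flip: exp_add)
      show ?thesis using True h
        by (simp add: laplace_kernel_def blinfun.scaleR_right c0_semigroup_add[OF c0] e)
    qed (use h in \<open>auto simp: laplace_kernel_def split: split_indicator\<close>)
  qed
  also have "\<dots> = (LINT s|lborel. exp (l * h) *\<^sub>R
      (laplace_kernel l x s - indicator {0..<h} s *\<^sub>R laplace_kernel l x s))"
    using lborel_integral_real_affine[of 1 "\<lambda>s. exp (l * h) *\<^sub>R
      (laplace_kernel l x s - indicator {0..<h} s *\<^sub>R laplace_kernel l x s)" h] by simp
  also have "\<dots> = exp (l * h) *\<^sub>R
    (laplace l x - (LINT s|lborel. indicator {0..<h} s *\<^sub>R laplace_kernel l x s))"
    by (simp add: laplace_def integrable_laplace_kernel[OF l] integrable_mult_indicator)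
  finally show ?thesis .
qed

lemma laplace_kernel_average:
  assumes l: "l > \<omega>"
  shows "((\<lambda>h. (LINT s|lborel. indicator {0..<h} s *\<^sub>R laplace_kernel l x s) /\<^sub>R h) \<longlongrightarrow> x) (at_right 0)"
proof (rule tendstoI)
  fix e :: real assume e: "e > 0"
  define g where "g s = exp (- (l * s)) *\<^sub>R S (max 0 s) x" for s
  have "continuous_on UNIV g"
    unfolding g_def by (intro continuous_intros continuous_on_clamped_compose)
  then obtain d where d: "d > 0" "\<And>s. dist s 0 < d \<Longrightarrow> dist (g s) (g 0) < e / 2"
    using e unfolding continuous_on_iff by (metis UNIV_I half_gt_zero)
  have g0: "g 0 = x" by (simp add: g_def c0_semigroup_zero[OF c0])
  have bd: "dist ((LINT s|lborel. indicator {0..<h} s *\<^sub>R laplace_kernel l x s) /\<^sub>R h) x < e"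
    if h: "0 < h" "h < d" for h
  proof -
    have int: "integrable lborel (\<lambda>s. indicator {0..<h} s *\<^sub>R laplace_kernel l x s)"
      by (intro integrable_mult_indicator integrable_laplace_kernel l) simp
    have intx: "integrable lborel (\<lambda>s. indicator {0..<h} s *\<^sub>R y)" for y :: 'a
      using h by (intro integrable_scaleR_left) (simp add: integrable_indicator_iff)
    have inte: "integrable lborel (\<lambda>s. indicator {0..<h} s * (e / 2))"
      using h by (intro integrable_mult_left) (simp add: integrable_indicator_iff)
    let ?I = "LINT s|lborel. indicator {0..<h} s *\<^sub>R laplace_kernel l x s"
    have "?I - h *\<^sub>R x = (LINT s|lborel. indicator {0..<h} s *\<^sub>R laplace_kernel l x s - indicator {0..<h} s *\<^sub>R x)"
      using h by (subst Bochner_Integration.integral_diff[OF int intx]) simp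
    also have "norm \<dots> \<le> (LINT s|lborel. indicator {0..<h} s * (e / 2))"
    proof (rule Bochner_Integration.integral_norm_bound_integral)
      fix s :: real
      show "norm (indicator {0..<h} s *\<^sub>R laplace_kernel l x s - indicator {0..<h} s *\<^sub>R x)
          \<le> indicator {0..<h} s * (e / 2)"
        using d(2)[of s] h by (auto simp: laplace_kernel_def g0 dist_norm g_def[symmetric] split: split_indicator)
    qed (use int intx inte in auto)
    also have "\<dots> = h * (e / 2)" using h by simp
    finally have *: "norm (?I - h *\<^sub>R x) \<le> h * (e / 2)" .
    have "?I /\<^sub>R h - x = (1 / h) *\<^sub>R (?I - h *\<^sub>R x)"
      using h by (simp add: algebra_simps divide_inverse)
    then have "norm (?I /\<^sub>R h - x) = norm (?I - h *\<^sub>R x) / h" using h by simp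
    also have "\<dots> \<le> e / 2" using * h by (simp add: field_simps)
    finally show ?thesis using e by (simp add: dist_norm)
  qed
  show "\<forall>\<^sub>F h in at_right 0. dist ((LINT s|lborel. indicator {0..<h} s *\<^sub>R laplace_kernel l x s) /\<^sub>R h) x < e"
    unfolding eventually_at_right_field using d(1) bd by blast
qed

text \<open>By the shift formula the difference quotient is a combination of \<open>(exp (l h) - 1) / h\<close> and an
  average of the kernel over \<open>[0,h)\<close>, both of which converge.\<close>

lemma laplace_difference_quotient:
  assumes l: "l > \<omega>"
  shows "((\<lambda>h. (S h (laplace l x) - laplace l x) /\<^sub>R h) \<longlongrightarrow> l *\<^sub>R laplace l x - x) (at_right 0)"
proof -
  let ?I = "\<lambda>h. LINT s|lborel. indicator {0..<h} s *\<^sub>R laplace_kernel l x s"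
  have "((\<lambda>h. exp (l * h)) has_real_derivative l) (at 0)"
    by (auto intro!: derivative_eq_intros)
  then have "((\<lambda>h. (exp (l * h) - 1) / h) \<longlongrightarrow> l) (at 0)"
    by (simp add: DERIV_def)
  then have 1: "((\<lambda>h. (exp (l * h) - 1) / h) \<longlongrightarrow> l) (at_right 0)"
    by (rule tendsto_within_subset) simp
  have 2: "((\<lambda>h. exp (l * h)) \<longlongrightarrow> 1) (at_right 0)"
    by (rule tendsto_eq_intros refl | simp)+
  have "((\<lambda>h. ((exp (l * h) - 1) / h) *\<^sub>R laplace l x - exp (l * h) *\<^sub>R (?I h /\<^sub>R h))
      \<longlongrightarrow> l *\<^sub>R laplace l x - 1 *\<^sub>R x) (at_right 0)"
    by (intro tendsto_intros 1 2 laplace_kernel_average l)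
  then have "((\<lambda>h. ((exp (l * h) - 1) / h) *\<^sub>R laplace l x - exp (l * h) *\<^sub>R (?I h /\<^sub>R h))
      \<longlongrightarrow> l *\<^sub>R laplace l x - x) (at_right 0)" by simp
  moreover have "\<forall>\<^sub>F h in at_right 0. ((exp (l * h) - 1) / h) *\<^sub>R laplace l x - exp (l * h) *\<^sub>R (?I h /\<^sub>R h)
      = (S h (laplace l x) - laplace l x) /\<^sub>R h"
    unfolding eventually_at_right_field
    by (intro exI[of _ 1]) (auto simp: laplace_shift[OF l] algebra_simps divide_inverse)
  ultimately show ?thesis by (rule Lim_transform_eventually)
qed

lemma generator_laplace:
  assumes "generates D A S" "l > \<omega>"
  shows "laplace l x \<in> D" "A (laplace l x) = l *\<^sub>R laplace l x - x"
  using generates_domainI[OF assms(1) laplace_difference_quotient[OF assms(2)]] by auto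

text \<open>A bounded operator that commutes with the semigroup commutes with its generator.\<close>

lemma laplace_generator:
  assumes "generates D A S" "l > \<omega>" "x \<in> D"
  shows "laplace l (A x) = A (laplace l x)"
proof -
  interpret R: bounded_linear "laplace l" using bounded_linear_laplace assms by simp
  have "((\<lambda>h. laplace l ((S h x - x) /\<^sub>R h)) \<longlongrightarrow> laplace l (A x)) (at_right 0)"
    by (intro R.tendsto generates_domainD[OF assms(1,3)])
  moreover have "\<forall>\<^sub>F h in at_right 0. laplace l ((S h x - x) /\<^sub>R h) = (S h (laplace l x) - laplace l x) /\<^sub>R h"
    unfolding eventually_at_right_field
    by (intro exI[of _ 1]) (auto simp: R.scaleR R.diff laplace_commute[OF assms(2)])
  ultimately have "((\<lambda>h. (S h (laplace l x) - laplace l x) /\<^sub>R h) \<longlongrightarrow> laplace l (A x)) (at_right 0)"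
    by (rule Lim_transform_eventually)
  then show ?thesis by (rule generates_domainI(2)[OF assms(1), symmetric])
qed

text \<open>The difference quotient shows that \<open>laplace l\<close> is a right inverse of \<open>l - A\<close>; since it also
  commutes with \<open>A\<close>, it is a left inverse on the domain. In particular all large integers lie in
  the resolvent set.\<close>

lemma resolvent_eq_laplace:
  assumes gen: "generates D A S" and l: "l > \<omega>"
  shows "l \<in> resolvent_set D A" "blinfun_apply (resolvent D A l) = laplace l"
proof -
  interpret R: bounded_linear "laplace l" using bounded_linear_laplace l by simp
  let ?f = "\<lambda>x. l *\<^sub>R x - A x"
  have left: "laplace l (?f x) = x" if "x \<in> D" for x
    using that by (simp add: R.diff R.scaleR laplace_generator[OF gen l] generator_laplace[OF gen l])
  have right: "?f (laplace l x) = x" for x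
    by (simp add: generator_laplace[OF gen l])
  have inj: "inj_on ?f D" by (rule inj_on_inverseI[of D "laplace l"]) (rule left)
  have bij: "bij_betw ?f D UNIV"
  proof -
    have "y \<in> ?f ` D" for y
      by (rule image_eqI[where x = "laplace l y"]) (simp_all only: right generator_laplace(1)[OF gen l])
    then show ?thesis using inj by (auto simp: bij_betw_def)
  qed
  have inv: "inv_into D ?f = laplace l"
    by (rule ext, rule inv_into_f_eq[OF inj generator_laplace(1)[OF gen l] right])
  show "l \<in> resolvent_set D A"
    using bij inv bounded_linear_laplace[OF l] by (simp add: resolvent_set_def)
  show "blinfun_apply (resolvent D A l) = laplace l"
    by (simp add: resolvent_def inv bounded_linear_Blinfun_apply bounded_linear_laplace[OF l])
qed

text \<open>After the substitution \<open>u = n s\<close> the left-hand side is the mean of \<open>S (u / n) x\<close> against the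
  exponential density in \<open>u\<close>, and \<open>S (u / n) x\<close> tends to \<open>x\<close>.\<close>

lemma scaled_laplace_tendsto:
  "(\<lambda>n. real n *\<^sub>R laplace (real n) x) \<longlonglongrightarrow> x"
proof -
  define f where "f n u = indicator {0..} u *\<^sub>R (exp (- u) *\<^sub>R S (max 0 (u / real n)) x)" for n u
  \<comment> \<open>For \<open>n \<ge> 2 * \<omega>\<close> the growth \<open>exp (\<omega> u / n)\<close> costs at most half of the decay of \<open>exp (- u)\<close>,
    which gives an integrable majorant independent of \<open>n\<close>.\<close>
  define N where "N = nat \<lceil>2 * \<omega>\<rceil> + 1"
  have N: "real n \<ge> 2 * \<omega>" "n > 0" if "n \<ge> N" for n
    using that unfolding N_def by linarith+
  have meas: "f n \<in> borel_measurable lborel" for n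
    unfolding f_def by measurable
  have eq: "(LINT u|lborel. f n u) = real n *\<^sub>R laplace (real n) x" if "n > 0" for n
  proof -
    have "(LINT u|lborel. f n u) = real n *\<^sub>R (LINT s|lborel. f n (0 + real n * s))"
      using lborel_integral_real_affine[of "real n" "f n" 0] that by simp
    also have "(LINT s|lborel. f n (0 + real n * s)) = laplace (real n) x"
      unfolding laplace_def using that
      by (intro Bochner_Integration.integral_cong refl)
         (auto simp: f_def laplace_kernel_def zero_le_mult_iff split: split_indicator)
    finally show ?thesis .
  qed
  have "(\<lambda>i. LINT u|lborel. f (i + N) u) \<longlonglongrightarrow> (LINT u|lborel. indicator {0..} u *\<^sub>R (exp (- u) *\<^sub>R x))"
  proof (rule integral_dominated_convergence[where w = "\<lambda>u. (M * norm x) * (indicator {0..} u * exp (- (1 / 2 * u)))"])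
    show "integrable lborel (\<lambda>u. (M * norm x) * (indicator {0..} u * exp (- (1 / 2 * u))))"
      by (intro integrable_mult_right integrable_exp_decay) simp
    show "AE u in lborel. (\<lambda>i. f (i + N) u) \<longlonglongrightarrow> indicator {0..} u *\<^sub>R (exp (- u) *\<^sub>R x)"
    proof (rule AE_I2)
      fix u :: real
      have "(\<lambda>i. u / real (i + N)) \<longlonglongrightarrow> 0"
        by (intro LIMSEQ_ignore_initial_segment[where f = "\<lambda>i. u / real i"] lim_const_over_n)
      moreover have "continuous_on UNIV (\<lambda>t. S (max 0 t) x)"
        by (intro continuous_on_clamped_compose continuous_intros)
      ultimately have "(\<lambda>i. S (max 0 (u / real (i + N))) x) \<longlonglongrightarrow> S (max 0 0) x"
        using continuous_on_tendsto_compose[of UNIV "\<lambda>t. S (max 0 t) x"] by fastforce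
      then show "(\<lambda>i. f (i + N) u) \<longlonglongrightarrow> indicator {0..} u *\<^sub>R (exp (- u) *\<^sub>R x)"
        unfolding f_def by (intro tendsto_intros) (simp add: c0_semigroup_zero[OF c0])
    qed
    show "AE u in lborel. norm (f (i + N) u) \<le> (M * norm x) * (indicator {0..} u * exp (- (1 / 2 * u)))" for i
    proof (rule AE_I2)
      fix u :: real
      let ?n = "real (i + N)"
      show "norm (f (i + N) u) \<le> (M * norm x) * (indicator {0..} u * exp (- (1 / 2 * u)))"
      proof (cases "u \<ge> 0")
        case True
        have n: "?n \<ge> 2 * \<omega>" "?n > 0" using N[of "i + N"] by auto
        have "norm (f (i + N) u) = exp (- u) * norm (S (u / ?n) x)"
          using True n by (simp add: f_def)
        also have "\<dots> \<le> exp (- u) * (M * exp (\<omega> * (u / ?n)) * norm x)"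
          using True n by (intro mult_left_mono norm_apply_bound) auto
        also have "\<dots> = M * norm x * exp (- u + \<omega> * (u / ?n))" unfolding exp_add by simp
        also have "\<dots> \<le> M * norm x * exp (- (1 / 2 * u))"
        proof -
          have "2 * \<omega> * u \<le> ?n * u" using n True by (intro mult_right_mono) auto
          then have "\<omega> * (u / ?n) \<le> u / 2" using n by (simp add: field_simps)
          then have "- u + \<omega> * (u / ?n) \<le> - (1 / 2 * u)" by linarith
          then show ?thesis using M_ge_1 by (intro mult_left_mono) (simp_all only: exp_le_cancel_iff, simp)
        qed
        finally show ?thesis using True by simp
      qed (simp add: f_def)
    qed
  qed (use meas in auto)
  moreover have "(LINT u|lborel. indicator {0..} u *\<^sub>R (exp (- u) *\<^sub>R x)) = x"
    using integral_scaleR_left[where M = lborel and f = "\<lambda>u::real. indicator {0..} u * exp (- u)" and c = x]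
      integral_exp_decay[of 1] integrable_exp_decay[of 1] by simp
  moreover have "(LINT u|lborel. f (i + N) u) = real (i + N) *\<^sub>R laplace (real (i + N)) x" for i
    using N[of "i + N"] by (intro eq) auto
  ultimately have "(\<lambda>i. real (i + N) *\<^sub>R laplace (real (i + N)) x) \<longlonglongrightarrow> x" by simp
  then show ?thesis by (rule LIMSEQ_offset)
qed

text \<open>Feller's renorming. In this norm the rescaled semigroup \<open>exp (- \<omega> t) S t\<close> is contractive, so that
  the resolvent satisfies a bound with constant \<open>1\<close> instead of \<open>M\<close>. Powers of operators can then be
  estimated without the constant accumulating.\<close>

definition equiv_norm :: "'a \<Rightarrow> real" where
  "equiv_norm x = (SUP t\<in>{0..}. exp (- (\<omega> * t)) * norm (S t x))"

lemma weighted_orbit_bound: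
  assumes "t \<ge> 0" shows "exp (- (\<omega> * t)) * norm (S t x) \<le> M * norm x"
proof -
  have "exp (- (\<omega> * t)) * norm (S t x) \<le> exp (- (\<omega> * t)) * (M * exp (\<omega> * t) * norm x)"
    by (intro mult_left_mono norm_apply_bound assms) auto
  also have "\<dots> = M * norm x" by (simp add: exp_minus)
  finally show ?thesis .
qed

lemma weighted_orbit_le_equiv_norm:
  "t \<ge> 0 \<Longrightarrow> exp (- (\<omega> * t)) * norm (S t x) \<le> equiv_norm x"
  unfolding equiv_norm_def
  by (rule cSUP_upper) (auto intro!: bdd_aboveI2 weighted_orbit_bound)

lemma equiv_norm_least:
  "(\<And>t. t \<ge> 0 \<Longrightarrow> exp (- (\<omega> * t)) * norm (S t x) \<le> c) \<Longrightarrow> equiv_norm x \<le> c"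
  unfolding equiv_norm_def by (rule cSUP_least) auto

lemma norm_le_equiv_norm: "norm x \<le> equiv_norm x"
  using weighted_orbit_le_equiv_norm[of 0 x] by (simp add: c0_semigroup_zero[OF c0])

lemma equiv_norm_le: "equiv_norm x \<le> M * norm x"
  by (intro equiv_norm_least weighted_orbit_bound)

lemma norm_S_le_equiv_norm: "t \<ge> 0 \<Longrightarrow> norm (S t x) \<le> exp (\<omega> * t) * equiv_norm x"
  using weighted_orbit_le_equiv_norm[of t x] by (simp add: exp_minus field_simps)

lemma equiv_norm_nonneg: "equiv_norm x \<ge> 0"
  using norm_le_equiv_norm[of x] norm_ge_zero[of x] by linarith

lemma equiv_norm_triangle: "equiv_norm (x + y) \<le> equiv_norm x + equiv_norm y"
proof (rule equiv_norm_least)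
  fix t :: real assume t: "t \<ge> 0"
  have "exp (- (\<omega> * t)) * norm (S t (x + y))
      \<le> exp (- (\<omega> * t)) * norm (S t x) + exp (- (\<omega> * t)) * norm (S t y)"
    by (simp add: blinfun.add_right norm_triangle_ineq flip: distrib_left)
  also have "\<dots> \<le> equiv_norm x + equiv_norm y"
    by (intro add_mono weighted_orbit_le_equiv_norm t)
  finally show "exp (- (\<omega> * t)) * norm (S t (x + y)) \<le> equiv_norm x + equiv_norm y" .
qed

lemma equiv_norm_scale:
  assumes "c \<ge> 0" shows "equiv_norm (c *\<^sub>R x) \<le> c * equiv_norm x"
proof (rule equiv_norm_least)
  fix t :: real assume t: "t \<ge> 0"
  show "exp (- (\<omega> * t)) * norm (S t (c *\<^sub>R x)) \<le> c * equiv_norm x"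
    using mult_left_mono[OF weighted_orbit_le_equiv_norm[OF t, of x] assms] assms
    by (simp add: blinfun.scaleR_right mult_ac)
qed

lemma equiv_norm_laplace:
  assumes l: "l > \<omega>" shows "equiv_norm (laplace l x) \<le> equiv_norm x / (l - \<omega>)"
proof (rule equiv_norm_least)
  fix t :: real assume t: "t \<ge> 0"
  have "norm (S t (laplace l x)) = norm (LINT s|lborel. laplace_kernel l (S t x) s)"
    by (simp only: laplace_commute[OF l t]) (simp only: laplace_def)
  also have "\<dots> \<le> (LINT s|lborel. (exp (\<omega> * t) * equiv_norm x) * (indicator {0..} s * exp (- ((l - \<omega>) * s))))"
  proof (rule Bochner_Integration.integral_norm_bound_integral[OF integrable_laplace_kernel[OF l]])
    show "integrable lborel (\<lambda>s. (exp (\<omega> * t) * equiv_norm x) * (indicator {0..} s * exp (- ((l - \<omega>) * s))))"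
      using l by (intro integrable_mult_right integrable_exp_decay) auto
    fix s :: real
    show "norm (laplace_kernel l (S t x) s)
        \<le> (exp (\<omega> * t) * equiv_norm x) * (indicator {0..} s * exp (- ((l - \<omega>) * s)))"
    proof (cases "s \<ge> 0")
      case True
      have "norm (laplace_kernel l (S t x) s) = exp (- (l * s)) * norm (S (s + t) x)"
        using True t by (simp add: laplace_kernel_def c0_semigroup_add[OF c0])
      also have "\<dots> \<le> exp (- (l * s)) * (exp (\<omega> * (s + t)) * equiv_norm x)"
        using True t by (intro mult_left_mono norm_S_le_equiv_norm) auto
      also have "\<dots> = exp (\<omega> * t) * equiv_norm x * exp (- ((l - \<omega>) * s))"
        by (simp add: algebra_simps flip: exp_add)
      finally show ?thesis using True by simp
    qed (simp add: laplace_kernel_def)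
  qed
  also have "\<dots> = exp (\<omega> * t) * (equiv_norm x / (l - \<omega>))"
    using l integral_exp_decay[of "l - \<omega>"] by simp
  finally show "exp (- (\<omega> * t)) * norm (S t (laplace l x)) \<le> equiv_norm x / (l - \<omega>)"
    by (simp add: exp_minus field_simps)
qed

end


section \<open>Convergence of the Yosida semigroups\<close>

lemma linear_funpow_diff:
  fixes V :: "'a::real_normed_vector \<Rightarrow>\<^sub>L 'a"
  shows "(blinfun_apply V ^^ i) (x - y) = (blinfun_apply V ^^ i) x - (blinfun_apply V ^^ i) y"
  by (induction i) (simp_all add: blinfun.diff_right)

lemma funpow_commute_apply:
  assumes "\<And>x. f (g x) = g (f x)"
  shows "f ((g ^^ i) x) = (g ^^ i) (f x)"
  by (induction i) (simp_all add: assms)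

text \<open>Telescoping: \<open>U\<^sup>m - V\<^sup>m\<close> is the sum of the terms \<open>U\<^sup>k (U - V) V\<^sup>i\<close> with \<open>k + i + 1 = m\<close>, and
  commutativity moves \<open>U - V\<close> onto \<open>x\<close>. Applied to two semigroups with time step \<open>t / m\<close>, this turns
  a difference of first order at time \<open>0\<close> into an estimate at time \<open>t\<close>.\<close>

lemma norm_funpow_diff_le:
  fixes U V :: "'a::real_normed_vector \<Rightarrow>\<^sub>L 'a"
  assumes comm: "\<And>x. U (V x) = V (U x)"
    and K1: "\<And>j x. j \<le> m \<Longrightarrow> norm ((blinfun_apply U ^^ j) x) \<le> K1 * norm x"
    and K2: "\<And>j x. j \<le> m \<Longrightarrow> norm ((blinfun_apply V ^^ j) x) \<le> K2 * norm x"
    and K1_nonneg: "K1 \<ge> 0"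
  shows "norm ((blinfun_apply U ^^ m) x - (blinfun_apply V ^^ m) x)
           \<le> real m * (K1 * K2 * norm (U x - V x))"
proof -
  let ?U = "blinfun_apply U" and ?V = "blinfun_apply V"
  have "norm ((?U ^^ k) ((?V ^^ i) x) - (?V ^^ (k + i)) x) \<le> real k * (K1 * K2 * norm (U x - V x))"
    if "k + i \<le> m" for k i
    using that
  proof (induction k arbitrary: i)
    case (Suc k)
    let ?d = "(?V ^^ i) (U x - V x)"
    have "(?U ^^ Suc k) ((?V ^^ i) x) - (?V ^^ (Suc k + i)) x
        = (?U ^^ k) ?d + ((?U ^^ k) ((?V ^^ Suc i) x) - (?V ^^ (k + Suc i)) x)"
      using funpow_commute_apply[of ?U ?V i x, OF comm]
      by (simp add: funpow_swap1 linear_funpow_diff)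
    also have "norm \<dots> \<le> norm ((?U ^^ k) ?d) + norm ((?U ^^ k) ((?V ^^ Suc i) x) - (?V ^^ (k + Suc i)) x)"
      by (rule norm_triangle_ineq)
    also have "norm ((?U ^^ k) ((?V ^^ Suc i) x) - (?V ^^ (k + Suc i)) x) \<le> real k * (K1 * K2 * norm (U x - V x))"
      using Suc.prems by (intro Suc.IH) simp
    also have "norm ((?U ^^ k) ?d) \<le> K1 * (K2 * norm (U x - V x))"
      using Suc.prems by (intro order_trans[OF K1] mult_left_mono K2 K1_nonneg) auto
    finally show ?case by (simp add: algebra_simps)
  qed simp
  from this[of m 0] show ?thesis by simp
qed

lemma c0_semigroup_funpow:
  assumes "c0_semigroup S" "h \<ge> 0"
  shows "(blinfun_apply (S h) ^^ j) x = S (real j * h) x"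
proof (induction j)
  case (Suc j)
  have "S (h + real j * h) x = S h (S (real j * h) x)"
    using assms by (intro c0_semigroup_add) auto
  then show ?case using Suc by (simp add: algebra_simps)
qed (simp add: c0_semigroup_zero[OF assms(1)])

lemma bounded_generator_commute:
  assumes gen: "generates UNIV (blinfun_apply B) S" and h: "h \<ge> 0"
  shows "S h (B x) = B (S h x)"
proof -
  have c0: "c0_semigroup S" using gen by (simp add: generates_def)
  have "((\<lambda>k. S h ((S k x - x) /\<^sub>R k)) \<longlongrightarrow> S h (B x)) (at_right 0)"
    by (intro tendsto_intros generates_domainD[OF gen]) simp
  moreover have "\<forall>\<^sub>F k in at_right 0. S h ((S k x - x) /\<^sub>R k) = (S k (S h x) - S h x) /\<^sub>R k"
    unfolding eventually_at_right_field
    by (intro exI[of _ 1]) (auto simp: blinfun.scaleR_right blinfun.diff_right c0_semigroup_commute[OF c0 h])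
  ultimately have "((\<lambda>k. (S k (S h x) - S h x) /\<^sub>R k) \<longlongrightarrow> S h (B x)) (at_right 0)"
    by (rule Lim_transform_eventually)
  then show ?thesis by (rule generates_domainI(2)[OF gen, symmetric])
qed

lemma filterlim_divide_at_right_0:
  assumes "(t::real) > 0"
  shows "filterlim (\<lambda>m. t / real (Suc m)) (at_right 0) sequentially"
proof -
  have "(\<lambda>m. t / real (Suc m)) \<longlonglongrightarrow> 0"
    using LIMSEQ_Suc[OF lim_const_over_n[of t]] .
  moreover have "t / real (Suc m) > 0" for m using assms by simp
  ultimately show ?thesis
    unfolding filterlim_at by (intro conjI always_eventually allI) (auto simp del: of_nat_Suc)
qed

lemma scaled_step_le:
  fixes t :: real
  assumes "j \<le> Suc m" "t \<ge> 0"
  shows "real j * (t / real (Suc m)) \<le> t"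
proof -
  have "real j * t \<le> real (Suc m) * t" using assms by (intro mult_right_mono) auto
  then show ?thesis by (simp add: divide_le_eq mult.commute del: of_nat_Suc)
qed

text \<open>A semigroup with a bounded generator \<open>B\<close> is determined by \<open>B\<close>: it is the limit of the explicit
  Euler scheme. One step of size \<open>h\<close> deviates from \<open>S h x\<close> by \<open>o(h)\<close>, and telescoping over \<open>t / h\<close> steps
  leaves an error tending to \<open>0\<close>. Norm bounds and commutation relations of \<open>S\<close> can thus be read off
  from \<open>B\<close>. The step number is \<open>Suc m\<close> to avoid division by zero.\<close>

lemma euler_formula:
  fixes S :: "real \<Rightarrow> 'a::banach \<Rightarrow>\<^sub>L 'a"
  assumes gen: "generates UNIV (blinfun_apply B) S" and t: "t \<ge> 0"
  shows "(\<lambda>m. (blinfun_apply (id_blinfun + (t / real (Suc m)) *\<^sub>R B) ^^ Suc m) x) \<longlonglongrightarrow> S t x"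
proof (cases "t = 0")
  case True
  have "(blinfun_apply (id_blinfun :: 'a \<Rightarrow>\<^sub>L 'a) ^^ m) x = x" for m
    by (induction m) simp_all
  then show ?thesis using gen by (simp add: True generates_def c0_semigroup_zero)
next
  case False
  then have t: "t > 0" using t by simp
  have c0: "c0_semigroup S" using gen by (simp add: generates_def)
  obtain M \<omega> where M: "M \<ge> 1" "\<omega> \<ge> 0" "\<And>t. t \<ge> 0 \<Longrightarrow> norm (S t) \<le> M * exp (\<omega> * t)"
    using c0_semigroup_exponential_bound[OF c0] by blast
  define h where "h m = t / real (Suc m)" for m
  have h: "h m > 0" for m using t by (simp add: h_def)
  define V where "V m = id_blinfun + h m *\<^sub>R B" for m
  let ?K = "M * exp (\<omega> * t) * exp (t * norm B)"
  have bound: "norm ((blinfun_apply (S (h m)) ^^ Suc m) x - (blinfun_apply (V m) ^^ Suc m) x)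
      \<le> real (Suc m) * (?K * norm (S (h m) x - V m x))" for m
  proof (rule norm_funpow_diff_le)
    show "S (h m) (V m y) = V m (S (h m) y)" for y
      using h[of m]
      by (simp add: V_def blinfun.bilinear_simps bounded_generator_commute[OF gen])
    show "norm ((blinfun_apply (S (h m)) ^^ j) y) \<le> M * exp (\<omega> * t) * norm y" if "j \<le> Suc m" for j y
    proof -
      have jt: "real j * h m \<le> t" unfolding h_def using that t by (intro scaled_step_le) auto
      have "norm (S (real j * h m) y) \<le> norm (S (real j * h m)) * norm y" by (rule norm_blinfun)
      also have "\<dots> \<le> M * exp (\<omega> * (real j * h m)) * norm y"
        using h[of m] by (intro mult_right_mono M) auto
      also have "\<dots> \<le> M * exp (\<omega> * t) * norm y"
        using jt M by (intro mult_right_mono mult_left_mono) (auto intro!: mult_left_mono)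
      finally show ?thesis using h[of m] by (simp add: c0_semigroup_funpow[OF c0])
    qed
    show "norm ((blinfun_apply (V m) ^^ j) y) \<le> exp (t * norm B) * norm y" if "j \<le> Suc m" for j y
    proof -
      have "norm (V m y) \<le> exp (h m * norm B) * norm y" for y
      proof -
        have "norm (V m y) \<le> norm y + h m * norm (B y)"
          unfolding V_def using norm_triangle_ineq[of y "h m *\<^sub>R B y"] h[of m]
          by (simp add: blinfun.bilinear_simps)
        also have "\<dots> \<le> norm y + h m * (norm B * norm y)"
          using h[of m] by (intro add_left_mono mult_left_mono norm_blinfun) auto
        also have "\<dots> = (1 + h m * norm B) * norm y" by (simp add: algebra_simps)
        also have "\<dots> \<le> exp (h m * norm B) * norm y"
          by (intro mult_right_mono exp_ge_add_one_self) auto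
        finally show ?thesis .
      qed
      then have "norm ((blinfun_apply (V m) ^^ j) y) \<le> exp (h m * norm B) ^ j * norm y"
      proof (induction j)
        case (Suc j)
        have "norm ((blinfun_apply (V m) ^^ Suc j) y) \<le> exp (h m * norm B) * norm ((blinfun_apply (V m) ^^ j) y)"
          using Suc.prems by simp
        also have "\<dots> \<le> exp (h m * norm B) * (exp (h m * norm B) ^ j * norm y)"
          using Suc by (intro mult_left_mono) auto
        finally show ?case by (simp add: mult_ac)
      qed simp
      also have "exp (h m * norm B) ^ j = exp ((real j * h m) * norm B)"
        by (simp add: mult.assoc flip: exp_of_nat_mult)
      also have "\<dots> \<le> exp (t * norm B)"
      proof -
        have "real j * h m \<le> t" unfolding h_def using that t by (intro scaled_step_le) auto
        then show ?thesis by (simp add: mult_right_mono)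
      qed
      finally show ?thesis by (simp add: mult_right_mono)
    qed
    show "0 \<le> M * exp (\<omega> * t)" using M by simp
  qed
  have eq: "real (Suc m) * (?K * norm (S (h m) x - V m x)) = ?K * t * norm ((S (h m) x - x) /\<^sub>R h m - B x)" for m
  proof -
    have "(S (h m) x - x) /\<^sub>R h m - B x = (S (h m) x - V m x) /\<^sub>R h m"
      using h[of m] by (simp add: V_def blinfun.bilinear_simps algebra_simps)
    then have "norm ((S (h m) x - x) /\<^sub>R h m - B x) = norm (S (h m) x - V m x) / h m"
      using h[of m] by (simp add: divide_inverse_commute)
    then have q: "norm (S (h m) x - V m x) = h m * norm ((S (h m) x - x) /\<^sub>R h m - B x)"
      using h[of m] by simp
    have hm: "real (Suc m) * h m = t" by (simp add: h_def)
    have "real (Suc m) * (?K * (h m * c)) = ?K * (real (Suc m) * h m) * c" for c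
      by (simp only: mult_ac)
    then show ?thesis unfolding q hm .
  qed
  have fl: "filterlim h (at_right 0) sequentially"
    unfolding h_def using t by (rule filterlim_divide_at_right_0)
  have "(\<lambda>m. ?K * t * norm ((S (h m) x - x) /\<^sub>R h m - B x)) \<longlonglongrightarrow> ?K * t * norm (B x - B x)"
    by (intro tendsto_intros filterlim_compose[OF generates_domainD[OF gen] fl]) simp
  then have "(\<lambda>m. ?K * t * norm ((S (h m) x - x) /\<^sub>R h m - B x)) \<longlonglongrightarrow> 0" by simp
  then have "(\<lambda>m. (blinfun_apply (S (h m)) ^^ Suc m) x - (blinfun_apply (V m) ^^ Suc m) x) \<longlonglongrightarrow> 0"
    by (rule Lim_null_comparison[rotated]) (intro always_eventually allI bound[unfolded eq])
  moreover have "(blinfun_apply (S (h m)) ^^ Suc m) x = S t x" for m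
    unfolding c0_semigroup_funpow[OF c0 less_imp_le[OF h]] by (simp add: h_def)
  ultimately have "(\<lambda>m. S t x - (blinfun_apply (V m) ^^ Suc m) x) \<longlonglongrightarrow> 0" by simp
  then have "(\<lambda>m. S t x - (S t x - (blinfun_apply (V m) ^^ Suc m) x)) \<longlonglongrightarrow> S t x - 0"
    by (intro tendsto_intros)
  then show ?thesis by (simp add: V_def h_def)
qed

context exp_bounded_semigroup
begin

lemma yosida_eq:
  assumes gen: "generates D A S" and n: "real n > \<omega>"
  shows "yosida D A n x = (real n)\<^sup>2 *\<^sub>R laplace (real n) x - real n *\<^sub>R x"
  by (simp add: yosida_def blinfun.bilinear_simps resolvent_eq_laplace(2)[OF gen n])

text \<open>With \<open>R = R(n)\<close> an Euler step for the Yosida approximant equals \<open>(1 - h n) + h n\<^sup>2 R\<close>, which for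
  \<open>h n \<le> 1\<close> has nonnegative coefficients. The bound \<open>1 / (n - \<omega>)\<close> on \<open>R\<close> in the equivalent norm gives the
  growth factor \<open>1 + h n \<omega> / (n - \<omega>)\<close>, and \<open>n / (n - \<omega>) \<le> 2\<close>.\<close>

lemma equiv_norm_euler_step:
  assumes gen: "generates D A S" and n: "real n \<ge> 2 * \<omega>" "n > 0" and h: "h \<ge> 0" "h * real n \<le> 1"
  shows "equiv_norm ((id_blinfun + h *\<^sub>R yosida D A n) x) \<le> exp (2 * \<omega> * h) * equiv_norm x"
proof -
  let ?n = "real n"
  have n\<omega>: "?n > \<omega>" using n \<omega>_nonneg by linarith
  have "(id_blinfun + h *\<^sub>R yosida D A n) x = (1 - h * ?n) *\<^sub>R x + (h * ?n\<^sup>2) *\<^sub>R laplace ?n x"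
    by (simp add: blinfun.bilinear_simps yosida_eq[OF gen n\<omega>] algebra_simps)
  also have "equiv_norm \<dots> \<le> (1 - h * ?n) * equiv_norm x + (h * ?n\<^sup>2) * equiv_norm (laplace ?n x)"
    using h by (intro order_trans[OF equiv_norm_triangle] add_mono equiv_norm_scale) auto
  also have "\<dots> \<le> (1 - h * ?n) * equiv_norm x + (h * ?n\<^sup>2) * (equiv_norm x / (?n - \<omega>))"
    using h by (intro add_left_mono mult_left_mono equiv_norm_laplace n\<omega>) auto
  also have "\<dots> = (1 + h * (?n * \<omega> / (?n - \<omega>))) * equiv_norm x"
    using n\<omega> by (simp add: field_simps power2_eq_square)
  also have "\<dots> \<le> (1 + 2 * \<omega> * h) * equiv_norm x"
  proof -
    have "?n * \<omega> \<le> 2 * \<omega> * (?n - \<omega>)"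
      using mult_left_mono[OF n(1) \<omega>_nonneg] by (simp add: algebra_simps)
    then have "?n * \<omega> / (?n - \<omega>) \<le> 2 * \<omega>" using n\<omega> by (simp add: divide_le_eq)
    then have "h * (?n * \<omega> / (?n - \<omega>)) \<le> h * (2 * \<omega>)" using h by (intro mult_left_mono)
    then show ?thesis using equiv_norm_nonneg[of x] by (intro mult_right_mono) (auto simp: mult_ac)
  qed
  also have "\<dots> \<le> exp (2 * \<omega> * h) * equiv_norm x"
    by (intro mult_right_mono exp_ge_add_one_self equiv_norm_nonneg)
  finally show ?thesis .
qed

text \<open>The stability estimate: a bound independent of \<open>n\<close>, with the same constant \<open>M\<close> as for \<open>S\<close>.
  It follows by iterating the Euler step in the equivalent norm, because the passage to the
  original norm and back costs the factor \<open>M\<close> only once.\<close>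

lemma yosida_semigroup_bound:
  assumes gen: "generates D A S" and n: "real n \<ge> 2 * \<omega>" "n > 0"
    and Sn: "generates UNIV (blinfun_apply (yosida D A n)) Sn" and t: "t \<ge> 0"
  shows "norm (Sn t x) \<le> M * exp (2 * \<omega> * t) * norm x"
proof (rule tendsto_upperbound)
  let ?V = "\<lambda>m. blinfun_apply (id_blinfun + (t / real (Suc m)) *\<^sub>R yosida D A n)"
  show "(\<lambda>m. norm ((?V m ^^ Suc m) x)) \<longlonglongrightarrow> norm (Sn t x)"
    by (intro tendsto_norm euler_formula Sn t)
  have step: "equiv_norm ((?V m ^^ j) x) \<le> exp (2 * \<omega> * (t / real (Suc m))) ^ j * equiv_norm x"
    if m: "t * real n \<le> real (Suc m)" for m j
  proof (induction j)
    case (Suc j)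
    have "equiv_norm ((?V m ^^ Suc j) x) \<le> exp (2 * \<omega> * (t / real (Suc m))) * equiv_norm ((?V m ^^ j) x)"
      unfolding funpow.simps o_apply
      by (rule equiv_norm_euler_step[OF gen n])
         (use m t in \<open>simp_all add: divide_le_eq del: of_nat_Suc\<close>)
    also have "\<dots> \<le> exp (2 * \<omega> * (t / real (Suc m))) * (exp (2 * \<omega> * (t / real (Suc m))) ^ j * equiv_norm x)"
      by (intro mult_left_mono Suc.IH) auto
    finally show ?case by (simp add: mult_ac)
  qed simp
  have "norm ((?V m ^^ Suc m) x) \<le> M * exp (2 * \<omega> * t) * norm x" if m: "t * real n \<le> real (Suc m)" for m
  proof -
    have "norm ((?V m ^^ Suc m) x) \<le> equiv_norm ((?V m ^^ Suc m) x)" by (rule norm_le_equiv_norm)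
    also have "\<dots> \<le> exp (2 * \<omega> * (t / real (Suc m))) ^ Suc m * equiv_norm x" by (rule step[OF m])
    also have "exp (2 * \<omega> * (t / real (Suc m))) ^ Suc m = exp (real (Suc m) * (2 * \<omega> * (t / real (Suc m))))"
      by (rule exp_of_nat_mult[symmetric])
    also have "real (Suc m) * (2 * \<omega> * (t / real (Suc m))) = 2 * \<omega> * t" by simp
    also have "exp (2 * \<omega> * t) * equiv_norm x \<le> exp (2 * \<omega> * t) * (M * norm x)"
      by (intro mult_left_mono equiv_norm_le) auto
    finally show ?thesis by (simp add: mult_ac)
  qed
  moreover have "\<forall>\<^sub>F m in sequentially. t * real n \<le> real (Suc m)"
  proof -
    obtain N where N: "t * real n \<le> real N" using real_arch_simple by blast
    show ?thesis by (intro eventually_sequentiallyI[of N] order_trans[OF N]) simp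
  qed
  ultimately show "\<forall>\<^sub>F m in sequentially. norm ((?V m ^^ Suc m) x) \<le> M * exp (2 * \<omega> * t) * norm x"
    by (auto elim: eventually_mono)
qed simp

lemma yosida_semigroup_commute:
  assumes gen: "generates D A S" and n: "real n > \<omega>"
    and Sn: "generates UNIV (blinfun_apply (yosida D A n)) Sn" and t: "t \<ge> 0" and s: "s \<ge> 0"
  shows "S s (Sn t x) = Sn t (S s x)"
proof -
  let ?V = "\<lambda>m. blinfun_apply (id_blinfun + (t / real (Suc m)) *\<^sub>R yosida D A n)"
  have "S s (?V m y) = ?V m (S s y)" for m y
    by (simp add: blinfun.bilinear_simps yosida_eq[OF gen n] laplace_commute[OF n s])
  then have "S s ((?V m ^^ Suc m) x) = (?V m ^^ Suc m) (S s x)" for m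
    by (rule funpow_commute_apply)
  moreover have "(\<lambda>m. S s ((?V m ^^ Suc m) x)) \<longlonglongrightarrow> S s (Sn t x)"
    by (intro tendsto_intros euler_formula Sn t)
  ultimately have "(\<lambda>m. (?V m ^^ Suc m) (S s x)) \<longlonglongrightarrow> S s (Sn t x)" by simp
  then show ?thesis
    using euler_formula[OF Sn t, of "S s x"] by (rule LIMSEQ_unique)
qed

text \<open>On the domain of \<open>A\<close> the two semigroups differ by at most a constant times the difference of
  their generators: telescoping with step \<open>t / m\<close> bounds the difference by that of the two
  difference quotients at \<open>0\<close>, for every \<open>m\<close>. The constant covers both semigroups, since
  \<open>exp (\<omega> T) \<le> exp (2 \<omega> T)\<close>.\<close>

lemma yosida_semigroup_diff:
  assumes gen: "generates D A S" and n: "real n \<ge> 2 * \<omega>" "n > 0"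
    and Sn: "generates UNIV (blinfun_apply (yosida D A n)) Sn" and t: "0 \<le> t" "t \<le> T" and x: "x \<in> D"
  shows "norm (Sn t x - S t x) \<le> T * (M * exp (2 * \<omega> * T))\<^sup>2 * norm (yosida D A n x - A x)"
proof (cases "t = 0")
  case True
  then show ?thesis using t Sn M_ge_1 by (simp add: generates_def c0_semigroup_zero c0)
next
  case False
  then have t0: "t > 0" using t by simp
  have n\<omega>: "real n > \<omega>" using n \<omega>_nonneg by linarith
  have c0n: "c0_semigroup Sn" using Sn by (simp add: generates_def)
  let ?K = "M * exp (2 * \<omega> * T)"
  define h where "h m = t / real (Suc m)" for m
  have h: "h m > 0" for m using t0 by (simp add: h_def)
  have K: "norm (Sn s y) \<le> ?K * norm y" "norm (S s y) \<le> ?K * norm y" if "0 \<le> s" "s \<le> T" for s y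
  proof -
    have 1: "exp (2 * \<omega> * s) \<le> exp (2 * \<omega> * T)" using that \<omega>_nonneg by (simp add: mult_left_mono)
    have "\<omega> * s \<le> (2 * \<omega>) * T" using that \<omega>_nonneg by (intro mult_mono) auto
    then have 2: "exp (\<omega> * s) \<le> exp (2 * \<omega> * T)" by simp
    show "norm (Sn s y) \<le> ?K * norm y"
      by (rule order_trans[OF yosida_semigroup_bound[OF gen n Sn that(1)]])
         (use 1 M_ge_1 in \<open>intro mult_right_mono mult_left_mono; simp\<close>)
    show "norm (S s y) \<le> ?K * norm y"
      by (rule order_trans[OF norm_apply_bound[OF that(1)]])
         (use 2 M_ge_1 in \<open>intro mult_right_mono mult_left_mono; simp\<close>)
  qed
  have bound: "norm (Sn t x - S t x) \<le> T * ?K\<^sup>2 * norm ((Sn (h m) x - x) /\<^sub>R h m - (S (h m) x - x) /\<^sub>R h m)" for m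
  proof -
    have jh: "real j * h m \<le> T" "0 \<le> real j * h m" if "j \<le> Suc m" for j
    proof -
      have "real j * h m \<le> t" unfolding h_def using that t0 by (intro scaled_step_le) auto
      then show "real j * h m \<le> T" using t by simp
    qed (use h[of m] in simp)
    have "norm ((blinfun_apply (Sn (h m)) ^^ Suc m) x - (blinfun_apply (S (h m)) ^^ Suc m) x)
        \<le> real (Suc m) * (?K * ?K * norm (Sn (h m) x - S (h m) x))"
    proof (rule norm_funpow_diff_le)
      show "Sn (h m) (S (h m) y) = S (h m) (Sn (h m) y)" for y
        using yosida_semigroup_commute[OF gen n\<omega> Sn] h[of m] by simp
      show "norm ((blinfun_apply (Sn (h m)) ^^ j) y) \<le> ?K * norm y" if "j \<le> Suc m" for j y
        using K(1) jh[OF that] h[of m] by (simp add: c0_semigroup_funpow[OF c0n])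
      show "norm ((blinfun_apply (S (h m)) ^^ j) y) \<le> ?K * norm y" if "j \<le> Suc m" for j y
        using K(2) jh[OF that] h[of m] by (simp add: c0_semigroup_funpow[OF c0])
      show "0 \<le> ?K" using M_ge_1 by simp
    qed
    moreover have "(blinfun_apply (S (h m)) ^^ Suc m) x = S t x" "(blinfun_apply (Sn (h m)) ^^ Suc m) x = Sn t x"
      unfolding c0_semigroup_funpow[OF c0 less_imp_le[OF h]] c0_semigroup_funpow[OF c0n less_imp_le[OF h]]
      by (simp_all add: h_def)
    ultimately have "norm (Sn t x - S t x) \<le> real (Suc m) * (?K * ?K * norm (Sn (h m) x - S (h m) x))" by simp
    also have "\<dots> = t * ?K\<^sup>2 * (norm (Sn (h m) x - S (h m) x) / h m)"
      using t0 by (simp add: h_def power2_eq_square)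
    also have "norm (Sn (h m) x - S (h m) x) / h m = norm ((Sn (h m) x - x) /\<^sub>R h m - (S (h m) x - x) /\<^sub>R h m)"
      using h[of m] by (simp add: divide_inverse_commute flip: scaleR_diff_right)
    also have "t * ?K\<^sup>2 * \<dots> \<le> T * ?K\<^sup>2 * \<dots>"
      using t by (intro mult_right_mono) auto
    finally show ?thesis .
  qed
  have fl: "filterlim h (at_right 0) sequentially"
    unfolding h_def using t0 by (rule filterlim_divide_at_right_0)
  have "(\<lambda>m. T * ?K\<^sup>2 * norm ((Sn (h m) x - x) /\<^sub>R h m - (S (h m) x - x) /\<^sub>R h m))
      \<longlonglongrightarrow> T * ?K\<^sup>2 * norm (yosida D A n x - A x)"
    by (intro tendsto_intros filterlim_compose[OF generates_domainD[OF Sn] fl]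
        filterlim_compose[OF generates_domainD[OF gen x] fl]) simp
  then show ?thesis
    by (rule tendsto_lowerbound) (use bound in auto)
qed

text \<open>On the domain, \<open>A\<^sub>n x = n A R(n) x = n R(n) A x\<close>.\<close>

lemma yosida_tendsto_generator:
  assumes gen: "generates D A S" and x: "x \<in> D"
  shows "(\<lambda>n. yosida D A n x) \<longlonglongrightarrow> A x"
proof -
  have "\<forall>\<^sub>F n in sequentially. real n *\<^sub>R laplace (real n) (A x) = yosida D A n x"
  proof -
    obtain N where N: "\<omega> < real N" using reals_Archimedean2 by blast
    show ?thesis
    proof (rule eventually_sequentiallyI[of N])
      fix n assume "n \<ge> N"
      then have n: "real n > \<omega>" using N by simp
      then show "real n *\<^sub>R laplace (real n) (A x) = yosida D A n x"
        by (simp add: yosida_eq[OF gen n] laplace_generator[OF gen n x] generator_laplace[OF gen n]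
            power2_eq_square algebra_simps)
    qed
  qed
  with scaled_laplace_tendsto show ?thesis by (rule Lim_transform_eventually)
qed

lemma domain_dense:
  assumes gen: "generates D A S" and e: "e > 0"
  shows "\<exists>y\<in>D. norm (x - y) < e"
proof -
  obtain N where N: "\<omega> < real N" using reals_Archimedean2 by blast
  have "\<forall>\<^sub>F n in sequentially. dist (real n *\<^sub>R laplace (real n) x) x < e"
    using scaled_laplace_tendsto e by (rule tendstoD)
  then obtain n where n: "n \<ge> N" "dist (real n *\<^sub>R laplace (real n) x) x < e"
    unfolding eventually_sequentially by (metis max.cobounded1 max.cobounded2)
  have n\<omega>: "real n > \<omega>" using n N by simp
  then have "real n *\<^sub>R laplace (real n) x = laplace (real n) (real n *\<^sub>R x)"
    by (simp add: linear_scale[OF bounded_linear.linear[OF bounded_linear_laplace]])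
  then have "real n *\<^sub>R laplace (real n) x \<in> D"
    using generator_laplace(1)[OF gen n\<omega>] by simp
  then show ?thesis using n by (auto simp: dist_norm norm_minus_commute)
qed

text \<open>The classical Trotter-Kato argument: uniform convergence holds on the dense domain, and the
  bounds independent of \<open>n\<close> extend it to every \<open>x\<close>.\<close>

lemma yosida_semigroups_converge:
  assumes gen: "generates D A S"
    and Sn: "\<And>n. n \<ge> N \<Longrightarrow> generates UNIV (blinfun_apply (yosida D A n)) (Sn n)"
    and N: "real N \<ge> 2 * \<omega>" "N > 0"
  shows "uniform_limit {0..T} (\<lambda>n t. Sn n t x) (\<lambda>t. S t x) sequentially"
proof (rule uniform_limitI)
  fix e :: real assume e: "e > 0"
  let ?K = "M * exp (2 * \<omega> * T)"
  have K: "?K > 0" using M_ge_1 by simp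
  obtain y where y: "y \<in> D" "norm (x - y) < e / (4 * ?K)"
    using domain_dense[OF gen, of "e / (4 * ?K)" x] e K by auto
  have "(\<lambda>n. T * ?K\<^sup>2 * norm (yosida D A n y - A y)) \<longlonglongrightarrow> T * ?K\<^sup>2 * norm (A y - A y)"
    by (intro tendsto_intros yosida_tendsto_generator gen y)
  then have "(\<lambda>n. T * ?K\<^sup>2 * norm (yosida D A n y - A y)) \<longlonglongrightarrow> 0" by simp
  then have "\<forall>\<^sub>F n in sequentially. T * ?K\<^sup>2 * norm (yosida D A n y - A y) < e / 2"
    using e by (intro order_tendstoD(2)[where y = 0]) auto
  then show "\<forall>\<^sub>F n in sequentially. \<forall>t\<in>{0..T}. dist (Sn n t x) (S t x) < e"
    using eventually_ge_at_top[of N]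
  proof eventually_elim
    case (elim n)
    have n: "real n \<ge> 2 * \<omega>" "n > 0" using elim(2) N by auto
    show ?case
    proof
      fix t assume t: "t \<in> {0..T}"
      have 1: "norm (Sn n t (x - y)) \<le> ?K * norm (x - y)"
      proof (rule order_trans[OF yosida_semigroup_bound[OF gen n Sn[OF elim(2)]]])
        have "2 * \<omega> * t \<le> 2 * \<omega> * T" using t \<omega>_nonneg by (intro mult_left_mono) auto
        then show "M * exp (2 * \<omega> * t) * norm (x - y) \<le> ?K * norm (x - y)"
          using M_ge_1 by (intro mult_right_mono mult_left_mono) auto
      qed (use t in auto)
      have 2: "norm (S t (x - y)) \<le> ?K * norm (x - y)"
      proof (rule order_trans[OF norm_apply_bound])
        have "\<omega> * t \<le> 2 * \<omega> * T" using t \<omega>_nonneg by (intro mult_mono) auto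
        then show "M * exp (\<omega> * t) * norm (x - y) \<le> ?K * norm (x - y)"
          using M_ge_1 by (intro mult_right_mono mult_left_mono) auto
      qed (use t in auto)
      have 3: "norm (Sn n t y - S t y) < e / 2"
        using yosida_semigroup_diff[OF gen n Sn[OF elim(2)] _ _ y(1), of t T] elim(1) t by auto
      have 4: "?K * norm (x - y) < e / 4" using y(2) K by (simp add: field_simps)
      have "Sn n t x - S t x = Sn n t (x - y) - S t (x - y) + (Sn n t y - S t y)"
        by (simp add: blinfun.bilinear_simps)
      also have "norm \<dots> \<le> norm (Sn n t (x - y)) + norm (S t (x - y)) + norm (Sn n t y - S t y)"
        by (intro order_trans[OF norm_triangle_ineq] add_right_mono norm_triangle_ineq4)
      finally show "dist (Sn n t x) (S t x) < e"
        unfolding dist_norm using 1 2 3 4 by linarith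
    qed
  qed
qed

end


section \<open>Causality of the delay operator\<close>

lemma integrable_lebesgue_on_subinterval:
  fixes f :: "real \<Rightarrow> 'b::{banach, second_countable_topology}"
  assumes "integrable (lebesgue_on {a..b}) f" "{c..d} \<subseteq> {a..b}"
  shows "integrable (lebesgue_on {c..d}) f"
proof -
  have "integrable lebesgue (\<lambda>x. indicator {a..b} x *\<^sub>R f x)"
    using assms(1) by (simp add: integrable_restrict_space)
  then have "integrable lebesgue (\<lambda>x. indicator {c..d} x *\<^sub>R (indicator {a..b} x *\<^sub>R f x))"
    by (rule integrable_mult_indicator[rotated]) simp
  moreover have "(\<lambda>x. indicator {c..d} x *\<^sub>R (indicator {a..b} x *\<^sub>R f x)) = (\<lambda>x. indicator {c..d} x *\<^sub>R f x)"
    using assms(2) by (auto split: split_indicator)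
  ultimately have "integrable lebesgue (\<lambda>x. indicator {c..d} x *\<^sub>R f x)" by metis
  then show ?thesis by (simp add: integrable_restrict_space)
qed

lemma integrable_continuous_lebesgue_on:
  fixes f :: "real \<Rightarrow> 'b::{banach, second_countable_topology}"
  assumes "continuous_on {a..b} f"
  shows "integrable (lebesgue_on {a..b}) f"
proof -
  have "bounded (f ` {a..b})"
    using assms by (intro compact_imp_bounded compact_continuous_image) auto
  then obtain B where B: "\<And>x. x \<in> {a..b} \<Longrightarrow> norm (f x) \<le> B"
    unfolding bounded_iff by (metis imageI)
  show ?thesis
  proof (rule Bochner_Integration.integrable_bound)
    show "integrable (lebesgue_on {a..b}) (\<lambda>x. B)" by simp
    show "f \<in> borel_measurable (lebesgue_on {a..b})"
      using assms by (intro continuous_imp_measurable_on_sets_lebesgue) auto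
    show "AE x in lebesgue_on {a..b}. norm (f x) \<le> norm B"
      using B by (intro AE_I2) force
  qed
qed

lemma L2_on_continuous:
  fixes f :: "real \<Rightarrow> 'b::{real_normed_vector, second_countable_topology}"
  assumes "continuous_on {a..b} f"
  shows "L2_on a b f"
  unfolding L2_on_def
  using assms by (intro conjI continuous_imp_measurable_on_sets_lebesgue
      integrable_continuous_lebesgue_on continuous_intros) auto

lemma L2_on_imp_integrable:
  fixes f :: "real \<Rightarrow> 'b::{banach, second_countable_topology}"
  assumes "L2_on a b f"
  shows "integrable (lebesgue_on {a..b}) f"
proof (rule Bochner_Integration.integrable_bound)
  show "integrable (lebesgue_on {a..b}) (\<lambda>x. 1 + (norm (f x))\<^sup>2)"
    using assms by (auto simp: L2_on_def)
  have "c \<le> 1 + c\<^sup>2" for c :: real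
    using zero_le_power2[of "c - 1"] zero_le_power2[of c]
    by (simp add: power2_diff) (smt (verit) zero_le_power2)
  then show "AE x in lebesgue_on {a..b}. norm (f x) \<le> norm (1 + (norm (f x))\<^sup>2)"
    by (intro AE_I2) (simp add: abs_of_nonneg)
qed (use assms in \<open>auto simp: L2_on_def\<close>)

lemma L2_on_add:
  assumes f: "L2_on a b f" and g: "L2_on a b g"
  shows "L2_on a b (\<lambda>x. f x + g x)"
proof -
  have [measurable]: "f \<in> borel_measurable (lebesgue_on {a..b})" "g \<in> borel_measurable (lebesgue_on {a..b})"
    using f g by (auto simp: L2_on_def)
  have "integrable (lebesgue_on {a..b}) (\<lambda>x. (norm (f x + g x))\<^sup>2)"
  proof (rule Bochner_Integration.integrable_bound)
    show "integrable (lebesgue_on {a..b}) (\<lambda>x. 2 * (norm (f x))\<^sup>2 + 2 * (norm (g x))\<^sup>2)"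
      using f g by (auto simp: L2_on_def)
    have "(norm (f x + g x))\<^sup>2 \<le> 2 * (norm (f x))\<^sup>2 + 2 * (norm (g x))\<^sup>2" for x
    proof -
      have "(norm (f x + g x))\<^sup>2 \<le> (norm (f x) + norm (g x))\<^sup>2"
        by (intro power_mono norm_triangle_ineq) auto
      also have "\<dots> \<le> 2 * (norm (f x))\<^sup>2 + 2 * (norm (g x))\<^sup>2"
        using zero_le_power2[of "norm (f x) - norm (g x)"] by (simp add: power2_diff power2_sum)
      finally show ?thesis .
    qed
    then show "AE x in lebesgue_on {a..b}. norm ((norm (f x + g x))\<^sup>2)
        \<le> norm (2 * (norm (f x))\<^sup>2 + 2 * (norm (g x))\<^sup>2)"
      by (intro AE_I2) (simp add: abs_of_nonneg)
  qed measurable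
  then show ?thesis by (simp add: L2_on_def)
qed

lemma L2_on_scaleR: "L2_on a b f \<Longrightarrow> L2_on a b (\<lambda>x. c *\<^sub>R f x)"
  by (auto simp: L2_on_def power_mult_distrib)

lemma L2_on_diff:
  assumes "L2_on a b f" "L2_on a b g" shows "L2_on a b (\<lambda>x. f x - g x)"
  using L2_on_add[OF assms(1) L2_on_scaleR[OF assms(2), of "-1"]] by simp

lemma AE_lebesgue_on_iff:
  "(AE x in lebesgue_on {a..b::real}. P x) \<longleftrightarrow> (AE x in lebesgue. x \<in> {a..b} \<longrightarrow> P x)"
  by (rule AE_restrict_space_iff) simp

text \<open>Integration by parts against the test function. It is carried out after pairing with an arbitrary
  vector \<open>v\<close>, which reduces it to the fundamental theorem of calculus for real-valued functions.\<close>

lemma weak_deriv_classical: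
  fixes y g :: "real \<Rightarrow> 'a::{real_inner, banach, second_countable_topology}"
  assumes der: "\<And>s. s \<in> {a..b} \<Longrightarrow> (y has_vector_derivative g s) (at s)"
    and cont: "continuous_on {a..b} g"
  shows "weak_deriv a b y g"
  unfolding weak_deriv_def
proof (intro allI impI)
  fix u assume u: "test_function a b u"
  have u1: "u differentiable (at t)" "deriv u differentiable (at t)" for t
    using u spec[of "\<lambda>k. \<forall>t. (deriv ^^ k) u differentiable at t" 0]
      spec[of "\<lambda>k. \<forall>t. (deriv ^^ k) u differentiable at t" 1]
    by (auto simp: test_function_def)
  have du: "(u has_real_derivative deriv u t) (at t)" for t
    using u1(1) by (simp add: DERIV_deriv_iff_real_differentiable)
  have cu: "continuous_on X u" "continuous_on X (deriv u)" for X
    using u1 by (auto intro!: continuous_at_imp_continuous_on differentiable_imp_continuous_within)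
  have cy: "continuous_on {a..b} y"
    using der by (intro continuous_at_imp_continuous_on) (blast intro: has_vector_derivative_continuous)
  obtain c d where "a < c" "d < b" "\<And>t. t \<notin> {c..d} \<Longrightarrow> u t = 0"
    using u by (auto simp: test_function_def)
  then have u0: "u a = 0" "u b = 0" by auto
  have i1: "integrable (lebesgue_on {a..b}) (\<lambda>t. deriv u t *\<^sub>R y t)"
    and i2: "integrable (lebesgue_on {a..b}) (\<lambda>t. u t *\<^sub>R g t)"
    by (intro integrable_continuous_lebesgue_on continuous_intros cu cy cont)+
  let ?J = "(LINT t|lebesgue_on {a..b}. deriv u t *\<^sub>R y t) + (LINT t|lebesgue_on {a..b}. u t *\<^sub>R g t)"
  have "?J \<bullet> v = 0" for v
  proof (cases "a \<le> b")
    case True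
    let ?f = "\<lambda>t. (deriv u t *\<^sub>R y t + u t *\<^sub>R g t) \<bullet> v"
    have "(?f has_integral (u b *\<^sub>R y b) \<bullet> v - (u a *\<^sub>R y a) \<bullet> v) {a..b}"
    proof (rule fundamental_theorem_of_calculus[OF True])
      fix t assume t: "t \<in> {a..b}"
      have "((\<lambda>t. u t *\<^sub>R y t) has_vector_derivative (u t *\<^sub>R g t + deriv u t *\<^sub>R y t)) (at t within {a..b})"
        by (intro has_vector_derivative_scaleR has_field_derivative_at_within[OF du]
            has_vector_derivative_at_within[OF der[OF t]])
      from bounded_linear.has_vector_derivative[OF bounded_linear_inner_left this, of v]
      show "((\<lambda>t. (u t *\<^sub>R y t) \<bullet> v) has_vector_derivative ?f t) (at t within {a..b})"
        by (simp add: add.commute)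
    qed
    then have "integral {a..b} ?f = 0" by (simp add: u0 integral_unique)
    moreover have "integrable (lebesgue_on {a..b}) ?f"
      by (intro integrable_continuous_lebesgue_on continuous_intros cu cy cont)
    ultimately have "(LINT t|lebesgue_on {a..b}. ?f t) = 0"
      by (simp add: lebesgue_integral_eq_integral)
    moreover have "(LINT t|lebesgue_on {a..b}. ?f t) = ?J \<bullet> v"
      using i1 i2 by (subst integral_inner_left) auto
    ultimately show ?thesis by simp
  qed simp
  then have "?J = 0" using inner_eq_zero_iff by blast
  then show "(LINT t|lebesgue_on {a..b}. deriv u t *\<^sub>R y t) = - (LINT t|lebesgue_on {a..b}. u t *\<^sub>R g t)"
    by (simp add: eq_neg_iff_add_eq_0)
qed

text \<open>A segment that vanishes on \<open>[a,b]\<close> has weak derivative \<open>0\<close> there, whatever its values elsewhere.\<close>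

lemma W12_bounded_linear_eq_0:
  assumes F: "W12_bounded_linear a b F" and y: "\<And>t. t \<in> {a..b} \<Longrightarrow> y t = 0"
  shows "F y = 0"
proof -
  obtain C where C: "\<And>y g. L2_on a b y \<Longrightarrow> L2_on a b g \<Longrightarrow> weak_deriv a b y g \<Longrightarrow>
        norm (F y) \<le> C * sqrt ((LINT t|lebesgue_on {a..b}. (norm (y t))\<^sup>2)
                              + (LINT t|lebesgue_on {a..b}. (norm (g t))\<^sup>2))"
    using F unfolding W12_bounded_linear_def by blast
  have z: "L2_on a b (\<lambda>_. 0 :: 'a)" by (simp add: L2_on_def)
  have "continuous_on {a..b} y" by (rule continuous_on_eq[of _ "\<lambda>_. 0"]) (auto simp: y)
  then have "L2_on a b y" by (rule L2_on_continuous)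
  moreover have i0: "(LINT t|lebesgue_on {a..b}. h t *\<^sub>R y t) = 0" for h
    by (rule trans[OF Bochner_Integration.integral_cong[OF refl, of _ _ "\<lambda>_. 0"]]) (auto simp: y)
  then have "weak_deriv a b y (\<lambda>_. 0)" by (simp add: weak_deriv_def)
  moreover have "(LINT t|lebesgue_on {a..b}. (norm (y t))\<^sup>2) = 0"
    by (rule trans[OF Bochner_Integration.integral_cong[OF refl, of _ _ "\<lambda>_. 0"]]) (auto simp: y)
  ultimately show ?thesis using C[of y "\<lambda>_. 0"] z by simp
qed

text \<open>Subtracting a history \<open>y'\<close> that has no effect up to time \<open>t\<close> leaves \<open>E y\<close> unchanged on \<open>[0,t]\<close>.\<close>

lemma delay_extension_integral_le:
  assumes E: "delay_extension r T F E" and t: "0 \<le> t" "t \<le> T"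
    and M: "\<And>y. L2_on (-r) T y \<Longrightarrow> (LINT s|lebesgue_on {0..T}. (norm (E y s))\<^sup>2)
          \<le> M * (LINT s|lebesgue_on {-r..T}. (norm (y s))\<^sup>2)"
    and y: "L2_on (-r) T y" and y': "L2_on (-r) T y'"
    and E0: "AE s in lebesgue_on {0..t}. E y' s = 0"
  shows "(LINT s|lebesgue_on {0..t}. (norm (E y s))\<^sup>2)
    \<le> M * (LINT s|lebesgue_on {-r..T}. (norm (y s - y' s))\<^sup>2)"
proof -
  let ?d = "\<lambda>s. y s - y' s"
  have d: "L2_on (-r) T ?d" by (intro L2_on_diff y y')
  have "AE s in lebesgue_on {0..T}. E (\<lambda>s. ?d s + y' s) s = E ?d s + E y' s"
    using E d y' unfolding delay_extension_def by blast
  then have "AE s in lebesgue_on {0..t}. E y s = E ?d s"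
    using E0 t unfolding AE_lebesgue_on_iff by (auto elim!: eventually_elim2)
  then have "AE s in lebesgue_on {0..t}. (norm (E y s))\<^sup>2 \<le> (norm (E ?d s))\<^sup>2" by auto
  then have "(LINT s|lebesgue_on {0..t}. (norm (E y s))\<^sup>2) \<le> (LINT s|lebesgue_on {0..T}. (norm (E ?d s))\<^sup>2)"
    using E d t unfolding delay_extension_def
    by (intro integral_mono_lebesgue_on_AE) (auto simp: L2_on_def)
  also have "\<dots> \<le> M * (LINT s|lebesgue_on {-r..T}. (norm (?d s))\<^sup>2)" by (rule M[OF d])
  finally show ?thesis .
qed

text \<open>The extension is only known to act as \<open>F\<close> on Sobolev functions, so causality must be obtained by
  approximation. The backward averages \<open>q \<eta> s\<close> of \<open>w\<close> over \<open>[s - \<eta>, s]\<close> are continuously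
  differentiable, still vanish up to time \<open>t\<close> because they only look into the past, and converge
  uniformly to \<open>w\<close>. For them \<open>E (q \<eta>) s\<close> is \<open>F\<close> applied to the zero segment when \<open>s \<le> t\<close>.\<close>

lemma delay_extension_causal:
  fixes F :: "(real \<Rightarrow> 'a::{real_inner, banach, second_countable_topology}) \<Rightarrow> 'a"
  assumes E: "delay_extension r T F E" and F: "W12_bounded_linear (-r) 0 F"
    and r: "r > 0" and t: "0 \<le> t" "t \<le> T"
    and w: "continuous_on UNIV w" "\<And>s. s \<le> t \<Longrightarrow> w s = 0"
  shows "AE s in lebesgue_on {0..t}. E w s = 0"
proof -
  obtain M where M: "M > 0" "\<And>y. L2_on (-r) T y \<Longrightarrow> (LINT s|lebesgue_on {0..T}. (norm (E y s))\<^sup>2)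
          \<le> M * (LINT s|lebesgue_on {-r..T}. (norm (y s))\<^sup>2)"
    using E unfolding delay_extension_def by blast
  have wc: "continuous_on X w" for X using w(1) by (rule continuous_on_subset) simp
  \<comment> \<open>The left margin of \<open>2\<close> keeps \<open>s - \<eta>\<close> in the interior of the domain of \<open>W\<close> for \<open>\<eta> \<le> 1\<close>.\<close>
  define a where "a = - r - 2"
  define W where "W u = integral {a..u} w" for u
  have W0: "W u = 0" if "u \<le> t" for u
    unfolding W_def by (rule integral_unique, rule has_integral_is_0) (use that w(2) in auto)
  have dW: "(W has_vector_derivative w s) (at s)" if s: "a < s" "s < T + 1" for s
  proof -
    have "(W has_vector_derivative w s) (at s within {a..T + 1})"
      unfolding W_def by (rule integral_has_vector_derivative[OF wc]) (use s in auto)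
    then show ?thesis using s by (subst (asm) at_within_interior) auto
  qed
  define q where "q \<eta> s = (1 / \<eta>) *\<^sub>R (W s - W (s - \<eta>))" for \<eta> s
  have q0: "AE s in lebesgue_on {0..t}. E (q \<eta>) s = 0" and qL2: "L2_on (-r) T (q \<eta>)"
    if \<eta>: "0 < \<eta>" "\<eta> \<le> 1" for \<eta>
  proof -
    let ?g = "\<lambda>s. (1 / \<eta>) *\<^sub>R (w s - w (s - \<eta>))"
    have der: "(q \<eta> has_vector_derivative ?g s) (at s)" if "s \<in> {-r..T}" for s
    proof -
      have "(W has_vector_derivative w (s - \<eta>)) (at (s - \<eta>))"
        using that \<eta> by (intro dW) (auto simp: a_def)
      moreover have "((\<lambda>s. s - \<eta>) has_vector_derivative 1) (at s)"
        by (auto intro!: derivative_eq_intros)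
      ultimately have "(W \<circ> (\<lambda>s. s - \<eta>) has_vector_derivative 1 *\<^sub>R w (s - \<eta>)) (at s)"
        by (rule vector_diff_chain_at[rotated])
      then have 1: "((\<lambda>s. W (s - \<eta>)) has_vector_derivative w (s - \<eta>)) (at s)" by (simp add: o_def)
      have 2: "(W has_vector_derivative w s) (at s)"
        using that by (intro dW) (auto simp: a_def)
      show ?thesis unfolding q_def
        by (intro bounded_linear.has_vector_derivative[OF bounded_linear_scaleR_right]
            has_vector_derivative_diff 1 2)
    qed
    have cg: "continuous_on {-r..T} ?g"
      by (intro continuous_intros wc continuous_on_compose2[OF w(1)]) auto
    have cq: "continuous_on {-r..T} (q \<eta>)"
      using der by (intro continuous_at_imp_continuous_on) (blast intro: has_vector_derivative_continuous)
    show L2: "L2_on (-r) T (q \<eta>)" by (rule L2_on_continuous[OF cq])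
    have "W12 (-r) T (q \<eta>)"
      unfolding W12_def using L2 L2_on_continuous[OF cg] weak_deriv_classical[OF der cg] by blast
    then have "AE s in lebesgue_on {0..T}. E (q \<eta>) s = F (\<lambda>\<theta>. q \<eta> (s + \<theta>))"
      using E unfolding delay_extension_def by blast
    moreover have "F (\<lambda>\<theta>. q \<eta> (s + \<theta>)) = 0" if "s \<le> t" for s
      by (rule W12_bounded_linear_eq_0[OF F]) (use that \<eta> in \<open>auto simp: q_def W0\<close>)
    ultimately show "AE s in lebesgue_on {0..t}. E (q \<eta>) s = 0"
      unfolding AE_lebesgue_on_iff using t by (auto elim!: eventually_mono)
  qed
  have wL2: "L2_on (-r) T w" by (rule L2_on_continuous[OF wc])
  let ?I = "LINT s|lebesgue_on {0..t}. (norm (E w s))\<^sup>2"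
  have small: "?I \<le> M * ((T + r) * \<epsilon>\<^sup>2)" if \<epsilon>: "\<epsilon> > 0" for \<epsilon>
  proof -
    have "uniformly_continuous_on {a..T} w"
      by (rule compact_uniformly_continuous[OF wc]) simp
    then obtain d where d: "d > 0" "\<And>s s'. s \<in> {a..T} \<Longrightarrow> s' \<in> {a..T} \<Longrightarrow> dist s' s < d \<Longrightarrow> dist (w s') (w s) < \<epsilon>"
      unfolding uniformly_continuous_on_def using \<epsilon> by metis
    define \<eta> where "\<eta> = min 1 (d / 2)"
    have \<eta>: "0 < \<eta>" "\<eta> \<le> 1" "\<eta> < d" using d(1) by (auto simp: \<eta>_def)
    have close: "norm (w s - q \<eta> s) \<le> \<epsilon>" if s: "s \<in> {-r..T}" for s
    proof -
      have as: "a \<le> s - \<eta>" "s - \<eta> \<le> s" using s \<eta> by (auto simp: a_def)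
      have iw: "w integrable_on {c..e}" for c e by (rule integrable_continuous_real[OF wc])
      have "W s - W (s - \<eta>) = integral {s - \<eta>..s} w"
        unfolding W_def using Henstock_Kurzweil_Integration.integral_combine[OF as iw] by (simp add: algebra_simps)
      moreover have "integral {s - \<eta>..s} (\<lambda>u. w u - w s) = integral {s - \<eta>..s} w - \<eta> *\<^sub>R w s"
        using \<eta> iw by (subst Henstock_Kurzweil_Integration.integral_diff) auto
      ultimately have "integral {s - \<eta>..s} (\<lambda>u. w u - w s) = \<eta> *\<^sub>R (q \<eta> s - w s)"
        using \<eta> by (simp add: q_def algebra_simps)
      moreover have "norm (integral {s - \<eta>..s} (\<lambda>u. w u - w s)) \<le> \<epsilon> * (s - (s - \<eta>))"
      proof (rule integral_bound[OF as(2)])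
        show "continuous_on {s - \<eta>..s} (\<lambda>u. w u - w s)" by (intro continuous_intros wc)
        fix u assume "u \<in> {s - \<eta>..s}"
        then show "norm (w u - w s) \<le> \<epsilon>"
          using d(2)[of s u] s as \<eta> by (auto simp: dist_norm intro: less_imp_le)
      qed
      ultimately have "\<eta> * norm (q \<eta> s - w s) \<le> \<epsilon> * \<eta>" using \<eta> by simp
      then show ?thesis using \<eta> by (simp add: norm_minus_commute mult.commute)
    qed
    have "?I \<le> M * (LINT s|lebesgue_on {-r..T}. (norm (w s - q \<eta> s))\<^sup>2)"
      by (rule delay_extension_integral_le[OF E t M(2) wL2 qL2[OF \<eta>(1,2)] q0[OF \<eta>(1,2)]])
    also have "(LINT s|lebesgue_on {-r..T}. (norm (w s - q \<eta> s))\<^sup>2) \<le> (LINT s|lebesgue_on {-r..T}. \<epsilon>\<^sup>2)"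
    proof (rule Bochner_Integration.integral_mono)
      show "integrable (lebesgue_on {-r..T}) (\<lambda>s. (norm (w s - q \<eta> s))\<^sup>2)"
        using L2_on_diff[OF wL2 qL2[OF \<eta>(1,2)]] by (simp add: L2_on_def)
    qed (auto intro!: power_mono close)
    also have "(LINT s|lebesgue_on {-r..T}. \<epsilon>\<^sup>2) = (T + r) * \<epsilon>\<^sup>2"
      using t r by (simp add: measure_restrict_space)
    finally show ?thesis using M(1) by simp
  qed
  have "?I \<le> 0"
  proof (rule tendsto_lowerbound)
    have "((\<lambda>\<epsilon>. M * ((T + r) * \<epsilon>\<^sup>2)) \<longlongrightarrow> M * ((T + r) * 0\<^sup>2)) (at_right 0)"
      by (intro tendsto_intros)
    then show "((\<lambda>\<epsilon>. M * ((T + r) * \<epsilon>\<^sup>2)) \<longlongrightarrow> 0) (at_right 0)" by simp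
    show "\<forall>\<^sub>F \<epsilon> in at_right 0. ?I \<le> M * ((T + r) * \<epsilon>\<^sup>2)"
      unfolding eventually_at_right_field using small by (intro exI[of _ 1]) auto
  qed simp
  moreover have "?I \<ge> 0" by (intro Bochner_Integration.integral_nonneg) auto
  ultimately have I0: "?I = 0" by simp
  have "L2_on 0 T (E w)" using E wL2 unfolding delay_extension_def by blast
  then have "integrable (lebesgue_on {0..T}) (\<lambda>s. (norm (E w s))\<^sup>2)" by (simp add: L2_on_def)
  then have "integrable (lebesgue_on {0..t}) (\<lambda>s. (norm (E w s))\<^sup>2)"
    by (rule integrable_lebesgue_on_subinterval) (use t in auto)
  from integral_nonneg_eq_0_iff_AE[OF this] I0
  have "AE s in lebesgue_on {0..t}. (norm (E w s))\<^sup>2 = 0" by simp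
  then show ?thesis by simp
qed

text \<open>The bound on \<open>[0,T]\<close> localises with the same constant to every \<open>[0,t]\<close>, which is what a Gronwall
  argument needs. The cut-offs \<open>\<phi> k\<close> are continuous ramps approximating the indicator of \<open>(t,T]\<close>; by
  causality the part \<open>\<phi> k z\<close> does not influence \<open>E z\<close> on \<open>[0,t]\<close>.\<close>

lemma delay_extension_integral_le_past:
  fixes F :: "(real \<Rightarrow> 'a::{real_inner, banach, second_countable_topology}) \<Rightarrow> 'a"
  assumes E: "delay_extension r T F E" and F: "W12_bounded_linear (-r) 0 F"
    and r: "r > 0" and t: "0 \<le> t" "t \<le> T"
    and M: "\<And>y. L2_on (-r) T y \<Longrightarrow> (LINT s|lebesgue_on {0..T}. (norm (E y s))\<^sup>2)
          \<le> M * (LINT s|lebesgue_on {-r..T}. (norm (y s))\<^sup>2)"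
    and z: "continuous_on UNIV z"
  shows "(LINT s|lebesgue_on {0..t}. (norm (E z s))\<^sup>2)
    \<le> M * (LINT s|lebesgue_on {-r..t}. (norm (z s))\<^sup>2)"
proof -
  define \<phi> where "\<phi> k s = min 1 (max 0 (real k * (s - t)))" for k :: nat and s :: real
  have c\<phi>: "continuous_on X (\<phi> k)" for X k unfolding \<phi>_def by (intro continuous_intros)
  have zc: "continuous_on X z" for X using z by (rule continuous_on_subset) simp
  have \<phi>01: "0 \<le> \<phi> k s" "\<phi> k s \<le> 1" for k s by (auto simp: \<phi>_def)
  have le: "(LINT s|lebesgue_on {0..t}. (norm (E z s))\<^sup>2)
      \<le> M * (LINT s|lebesgue_on {-r..T}. (norm (z s - \<phi> k s *\<^sub>R z s))\<^sup>2)" for k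
  proof (rule delay_extension_integral_le[OF E t])
    show "L2_on (-r) T z" "L2_on (-r) T (\<lambda>s. \<phi> k s *\<^sub>R z s)"
      by (intro L2_on_continuous continuous_intros c\<phi> zc)+
    show "AE s in lebesgue_on {0..t}. E (\<lambda>s. \<phi> k s *\<^sub>R z s) s = 0"
    proof (rule delay_extension_causal[OF E F r t])
      show "continuous_on UNIV (\<lambda>s. \<phi> k s *\<^sub>R z s)" by (intro continuous_intros c\<phi> zc)
      show "\<phi> k s *\<^sub>R z s = 0" if "s \<le> t" for s
        using that by (simp add: \<phi>_def mult_nonneg_nonpos max_absorb1)
    qed
  qed (rule M)
  have "(\<lambda>k. LINT s|lebesgue_on {-r..T}. (norm (z s - \<phi> k s *\<^sub>R z s))\<^sup>2)
     \<longlonglongrightarrow> (LINT s|lebesgue_on {-r..T}. indicator {-r..t} s *\<^sub>R (norm (z s))\<^sup>2)"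
  proof (rule integral_dominated_convergence[where w = "\<lambda>s. (norm (z s))\<^sup>2"])
    show "integrable (lebesgue_on {-r..T}) (\<lambda>s. (norm (z s))\<^sup>2)"
      by (intro integrable_continuous_lebesgue_on continuous_intros zc)
    show "(\<lambda>s. (norm (z s - \<phi> k s *\<^sub>R z s))\<^sup>2) \<in> borel_measurable (lebesgue_on {-r..T})" for k
      by (intro continuous_imp_measurable_on_sets_lebesgue continuous_intros c\<phi> zc) simp
    have [measurable]: "z \<in> borel_measurable (lebesgue_on {-r..T})"
      by (intro continuous_imp_measurable_on_sets_lebesgue zc) simp
    have "(\<lambda>s. indicator {-r..t} s :: real) \<in> borel_measurable (lebesgue_on {-r..T})"
      by (intro measurable_restrict_space1 borel_measurable_indicator) simp
    then show "(\<lambda>s. indicator {-r..t} s *\<^sub>R (norm (z s))\<^sup>2) \<in> borel_measurable (lebesgue_on {-r..T})"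
      by measurable
    have "norm ((norm (z s - \<phi> k s *\<^sub>R z s))\<^sup>2) \<le> (norm (z s))\<^sup>2" for k s
    proof -
      have "z s - \<phi> k s *\<^sub>R z s = (1 - \<phi> k s) *\<^sub>R z s" by (simp add: algebra_simps)
      then have "norm (z s - \<phi> k s *\<^sub>R z s) \<le> norm (z s)"
        using \<phi>01[of k s] by (simp add: mult_left_le_one_le)
      then show ?thesis by (simp add: power_mono)
    qed
    then show "AE s in lebesgue_on {-r..T}. norm ((norm (z s - \<phi> k s *\<^sub>R z s))\<^sup>2) \<le> (norm (z s))\<^sup>2" for k
      by simp
    show "AE s in lebesgue_on {-r..T}. (\<lambda>k. (norm (z s - \<phi> k s *\<^sub>R z s))\<^sup>2)
        \<longlonglongrightarrow> indicator {-r..t} s *\<^sub>R (norm (z s))\<^sup>2"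
    proof (rule AE_I2)
      fix s assume "s \<in> space (lebesgue_on {-r..T})"
      then have s: "-r \<le> s" "s \<le> T" by auto
      show "(\<lambda>k. (norm (z s - \<phi> k s *\<^sub>R z s))\<^sup>2) \<longlonglongrightarrow> indicator {-r..t} s *\<^sub>R (norm (z s))\<^sup>2"
      proof (cases "s \<le> t")
        case True
        then have "\<phi> k s = 0" for k by (simp add: \<phi>_def mult_nonneg_nonpos max_absorb1)
        then show ?thesis using True s by simp
      next
        case False
        obtain N where N: "1 / (s - t) \<le> real N" using real_arch_simple by blast
        have "\<phi> k s = 1" if "k \<ge> N" for k
        proof -
          have "1 / (s - t) \<le> real k" using N that by (simp add: order_trans)
          then have "1 \<le> real k * (s - t)" using False by (simp add: divide_le_eq)
          then show ?thesis by (simp add: \<phi>_def)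
        qed
        then have "\<forall>\<^sub>F k in sequentially. (norm (z s - \<phi> k s *\<^sub>R z s))\<^sup>2 = 0"
          by (intro eventually_sequentiallyI[of N]) simp
        then show ?thesis using False by (simp add: tendsto_eventually)
      qed
    qed
  qed
  moreover have "(LINT s|lebesgue_on {-r..T}. indicator {-r..t} s *\<^sub>R (norm (z s))\<^sup>2)
      = (LINT s|lebesgue_on {-r..t}. (norm (z s))\<^sup>2)"
    using t by (auto simp: integral_restrict_space intro!: Bochner_Integration.integral_cong split: split_indicator)
  ultimately have "(\<lambda>k. M * (LINT s|lebesgue_on {-r..T}. (norm (z s - \<phi> k s *\<^sub>R z s))\<^sup>2))
      \<longlonglongrightarrow> M * (LINT s|lebesgue_on {-r..t}. (norm (z s))\<^sup>2)"
    by (intro tendsto_intros) simp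
  then show ?thesis by (rule tendsto_lowerbound) (use le in auto)
qed

lemma delay_extension_zero:
  assumes E: "delay_extension r T F E" and y: "\<And>s. s \<in> {-r..T} \<Longrightarrow> y s = 0"
  shows "AE s in lebesgue_on {0..T}. E y s = 0"
proof -
  obtain M where M: "\<And>y. L2_on (-r) T y \<Longrightarrow> (LINT s|lebesgue_on {0..T}. (norm (E y s))\<^sup>2)
          \<le> M * (LINT s|lebesgue_on {-r..T}. (norm (y s))\<^sup>2)"
    using E unfolding delay_extension_def by blast
  have "continuous_on {-r..T} y" by (rule continuous_on_eq[of _ "\<lambda>_. 0"]) (auto simp: y)
  then have L2: "L2_on (-r) T y" by (rule L2_on_continuous)
  have "(LINT s|lebesgue_on {-r..T}. (norm (y s))\<^sup>2) = 0"
    by (rule trans[OF Bochner_Integration.integral_cong[OF refl, of _ _ "\<lambda>_. 0"]]) (auto simp: y)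
  then have "(LINT s|lebesgue_on {0..T}. (norm (E y s))\<^sup>2) \<le> 0" using M[OF L2] by simp
  moreover have "(LINT s|lebesgue_on {0..T}. (norm (E y s))\<^sup>2) \<ge> 0"
    by (intro Bochner_Integration.integral_nonneg) auto
  moreover have "integrable (lebesgue_on {0..T}) (\<lambda>s. (norm (E y s))\<^sup>2)"
    using E L2 unfolding delay_extension_def L2_on_def by blast
  ultimately have "AE s in lebesgue_on {0..T}. (norm (E y s))\<^sup>2 = 0"
    using integral_nonneg_eq_0_iff_AE[of "lebesgue_on {0..T}" "\<lambda>s. (norm (E y s))\<^sup>2"] by simp
  then show ?thesis by simp
qed


section \<open>Convolutions with semigroups\<close>

context exp_bounded_semigroup
begin

lemma integrable_convolution_clamped:
  assumes f: "integrable (lebesgue_on {0..T}) f" and t: "t \<le> T"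
  shows "integrable (lebesgue_on {0..T}) (\<lambda>s. S (max 0 (t - s)) (f s))"
proof (rule Bochner_Integration.integrable_bound)
  let ?K = "M * exp (\<omega> * T)"
  show "integrable (lebesgue_on {0..T}) (\<lambda>s. ?K *\<^sub>R norm (f s))" using f by auto
  have [measurable]: "(\<lambda>s. s) \<in> borel_measurable (lebesgue_on {0..T})"
    by (intro continuous_imp_measurable_on_sets_lebesgue continuous_intros) simp
  have [measurable]: "f \<in> borel_measurable (lebesgue_on {0..T})" using f by simp
  show "(\<lambda>s. S (max 0 (t - s)) (f s)) \<in> borel_measurable (lebesgue_on {0..T})"
    by measurable
  show "AE s in lebesgue_on {0..T}. norm (S (max 0 (t - s)) (f s)) \<le> norm (?K *\<^sub>R norm (f s))"
  proof (rule AE_I2)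
    fix s assume "s \<in> space (lebesgue_on {0..T})"
    then have "norm (S (max 0 (t - s)) (f s)) \<le> ?K * norm (f s)"
      using t by (intro norm_apply_bound_upto) auto
    then show "norm (S (max 0 (t - s)) (f s)) \<le> norm (?K *\<^sub>R norm (f s))"
      using M_ge_1 by (simp add: abs_mult)
  qed
qed

lemma integrable_convolution:
  assumes f: "integrable (lebesgue_on {0..T}) f" and t: "t \<le> T"
  shows "integrable (lebesgue_on {0..t}) (\<lambda>s. S (t - s) (f s))"
proof -
  have "integrable (lebesgue_on {0..t}) (\<lambda>s. S (max 0 (t - s)) (f s))"
    by (rule integrable_lebesgue_on_subinterval[OF integrable_convolution_clamped[OF f t]]) (use t in simp)
  then show ?thesis
    by (rule Bochner_Integration.integrable_cong[THEN iffD1, rotated 2]) auto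
qed

lemma continuous_on_convolution:
  assumes f: "integrable (lebesgue_on {0..T}) f"
  shows "continuous_on {0..T} (\<lambda>t. LINT s|lebesgue_on {0..t}. S (t - s) (f s))"
proof -
  define g where "g t s = indicator {0..t} s *\<^sub>R S (max 0 (t - s)) (f s)" for t s
  have conv: "(LINT s|lebesgue_on {0..t}. S (t - s) (f s)) = (LINT s|lebesgue_on {0..T}. g t s)"
    if "t \<in> {0..T}" for t
    using that by (auto simp: integral_restrict_space g_def intro!: Bochner_Integration.integral_cong
        split: split_indicator)
  have gmeas: "g t \<in> borel_measurable (lebesgue_on {0..T})" if "t \<le> T" for t
  proof -
    have [measurable]: "(\<lambda>s. S (max 0 (t - s)) (f s)) \<in> borel_measurable (lebesgue_on {0..T})"
      using integrable_convolution_clamped[OF f that] by simp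
    have [measurable]: "(\<lambda>s. indicator {0..t} s :: real) \<in> borel_measurable (lebesgue_on {0..T})"
      by (intro measurable_restrict_space1 borel_measurable_indicator) simp
    show ?thesis unfolding g_def by measurable
  qed
  have "continuous_on {0..T} (\<lambda>t. LINT s|lebesgue_on {0..T}. g t s)"
    unfolding continuous_on_sequentially o_def
  proof (intro allI ballI impI, elim conjE)
    fix X t assume t: "t \<in> {0..T}" and X: "\<forall>n. X n \<in> {0..T}" "X \<longlonglongrightarrow> t"
    let ?K = "M * exp (\<omega> * T)"
    show "(\<lambda>n. LINT s|lebesgue_on {0..T}. g (X n) s) \<longlonglongrightarrow> (LINT s|lebesgue_on {0..T}. g t s)"
    proof (rule integral_dominated_convergence[where w = "\<lambda>s. ?K * norm (f s)"])
      show "integrable (lebesgue_on {0..T}) (\<lambda>s. ?K * norm (f s))" using f by auto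
      show "g t \<in> borel_measurable (lebesgue_on {0..T})" using t by (intro gmeas) auto
      show "g (X n) \<in> borel_measurable (lebesgue_on {0..T})" for n using X by (intro gmeas) auto
      show "AE s in lebesgue_on {0..T}. norm (g (X n) s) \<le> ?K * norm (f s)" for n
      proof (rule AE_I2)
        fix s assume s: "s \<in> space (lebesgue_on {0..T})"
        have "X n \<le> T" using X by auto
        then have "norm (S (max 0 (X n - s)) (f s)) \<le> ?K * norm (f s)"
          using s by (intro norm_apply_bound_upto) auto
        then show "norm (g (X n) s) \<le> ?K * norm (f s)"
          using M_ge_1 by (auto simp: g_def split: split_indicator)
      qed
      \<comment> \<open>The indicators of \<open>[0, X n]\<close> converge to that of \<open>[0, t]\<close> except possibly at \<open>s = t\<close>.\<close>
      have "AE s in lebesgue. s \<noteq> t" by (intro AE_completion AE_lborel_singleton)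
      then show "AE s in lebesgue_on {0..T}. (\<lambda>n. g (X n) s) \<longlonglongrightarrow> g t s"
        unfolding AE_lebesgue_on_iff
      proof (rule eventually_mono, intro impI)
        fix s assume st: "s \<noteq> t" and s: "s \<in> {0..T}"
        have "continuous_on UNIV (\<lambda>u. S (max 0 (u - s)) (f s))"
          by (intro continuous_on_clamped_compose continuous_intros)
        then have lim: "(\<lambda>n. S (max 0 (X n - s)) (f s)) \<longlonglongrightarrow> S (max 0 (t - s)) (f s)"
          using X(2) by (auto simp: continuous_on_sequentially o_def)
        have "\<forall>\<^sub>F n in sequentially. indicator {0..t} s = (indicator {0..X n} s :: real)"
        proof (cases "s < t")
          case True
          then have "\<forall>\<^sub>F n in sequentially. s < X n" using X(2) by (intro order_tendstoD)
          then show ?thesis by eventually_elim (use True s in auto)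
        next
          case False
          then have "\<forall>\<^sub>F n in sequentially. X n < s" using st X(2) by (intro order_tendstoD) auto
          then show ?thesis by eventually_elim (use False st s in auto)
        qed
        then have "(\<lambda>n. indicator {0..X n} s :: real) \<longlonglongrightarrow> indicator {0..t} s"
          by (intro tendsto_eventually) (auto elim: eventually_mono)
        then show "(\<lambda>n. g (X n) s) \<longlonglongrightarrow> g t s"
          unfolding g_def by (intro tendsto_intros lim)
      qed
    qed
  qed
  then show ?thesis by (rule continuous_on_eq) (simp add: conv)
qed

text \<open>The difference of the integrands is dominated by \<open>q n (f s)\<close>, where \<open>q n v\<close> is the supremum over
  \<open>[0,T]\<close> of \<open>norm (Sn n \<tau> v - S \<tau> v)\<close>. As a seminorm with a bound independent of \<open>n\<close>, \<open>q n\<close> is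
  continuous, so \<open>q n (f s)\<close> is measurable in \<open>s\<close>; it tends to \<open>0\<close> pointwise, and dominated
  convergence gives a bound independent of \<open>t\<close>.\<close>

lemma yosida_convolutions_converge:
  assumes gen: "generates D A S"
    and Sn: "\<And>n. n \<ge> N \<Longrightarrow> generates UNIV (blinfun_apply (yosida D A n)) (Sn n)"
    and N: "real N \<ge> 2 * \<omega>" "N > 0" and T: "T \<ge> 0"
    and f: "integrable (lebesgue_on {0..T}) f"
  shows "\<exists>\<epsilon>. \<epsilon> \<longlonglongrightarrow> 0 \<and> (\<forall>n\<ge>N. \<forall>t\<in>{0..T}.
    norm (LINT s|lebesgue_on {0..t}. Sn n (t - s) (f s) - S (t - s) (f s)) \<le> \<epsilon> n)"
proof -
  let ?K = "M * exp (2 * \<omega> * T)"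
  have bound: "norm (Sn n \<tau> v - S \<tau> v) \<le> 2 * ?K * norm v" if n: "n \<ge> N" and \<tau>: "\<tau> \<in> {0..T}" for n \<tau> v
  proof -
    have nn: "real n \<ge> 2 * \<omega>" "n > 0" using n N by auto
    have "2 * \<omega> * \<tau> \<le> 2 * \<omega> * T" "\<omega> * \<tau> \<le> (2 * \<omega>) * T"
      using \<tau> \<omega>_nonneg by (auto intro!: mult_left_mono mult_mono)
    then have "exp (2 * \<omega> * \<tau>) \<le> exp (2 * \<omega> * T)" "exp (\<omega> * \<tau>) \<le> exp (2 * \<omega> * T)"
      by simp_all
    then have "M * exp (2 * \<omega> * \<tau>) * norm v \<le> ?K * norm v" "M * exp (\<omega> * \<tau>) * norm v \<le> ?K * norm v"
      using M_ge_1 by (intro mult_right_mono mult_left_mono; simp)+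
    moreover have "norm (Sn n \<tau> v) \<le> M * exp (2 * \<omega> * \<tau>) * norm v"
      using yosida_semigroup_bound[OF gen nn Sn[OF n]] \<tau> by auto
    moreover have "norm (S \<tau> v) \<le> M * exp (\<omega> * \<tau>) * norm v"
      using norm_apply_bound \<tau> by auto
    ultimately show ?thesis using norm_triangle_ineq4[of "Sn n \<tau> v" "S \<tau> v"] by linarith
  qed
  define q where "q n v = (SUP \<tau>\<in>{0..T}. norm (Sn n \<tau> v - S \<tau> v))" for n v
  have bdd: "bdd_above ((\<lambda>\<tau>. norm (Sn n \<tau> v - S \<tau> v)) ` {0..T})" if "n \<ge> N" for n v
    using bound[OF that] by (intro bdd_aboveI2) blast
  have le_q: "norm (Sn n \<tau> v - S \<tau> v) \<le> q n v" if "n \<ge> N" "\<tau> \<in> {0..T}" for n \<tau> v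
    unfolding q_def by (rule cSUP_upper[OF that(2) bdd[OF that(1)]])
  have q_le: "q n v \<le> c" if "\<And>\<tau>. \<tau> \<in> {0..T} \<Longrightarrow> norm (Sn n \<tau> v - S \<tau> v) \<le> c" for n v c
    unfolding q_def using that T by (intro cSUP_least) auto
  have q0: "q n v \<ge> 0" if "n \<ge> N" for n v
    using le_q[OF that, of 0 v] T by (auto intro: order_trans[OF norm_ge_zero])
  have q_lip: "q n u \<le> q n v + 2 * ?K * norm (u - v)" if n: "n \<ge> N" for n u v
  proof (rule q_le)
    fix \<tau> assume \<tau>: "\<tau> \<in> {0..T}"
    have "Sn n \<tau> u - S \<tau> u = (Sn n \<tau> v - S \<tau> v) + (Sn n \<tau> (u - v) - S \<tau> (u - v))"
      by (simp add: blinfun.diff_right)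
    also have "norm \<dots> \<le> norm (Sn n \<tau> v - S \<tau> v) + norm (Sn n \<tau> (u - v) - S \<tau> (u - v))"
      by (rule norm_triangle_ineq)
    also have "\<dots> \<le> q n v + 2 * ?K * norm (u - v)"
      by (intro add_mono le_q bound n \<tau>)
    finally show "norm (Sn n \<tau> u - S \<tau> u) \<le> q n v + 2 * ?K * norm (u - v)" .
  qed
  have q_cont: "continuous_on UNIV (q n)" if n: "n \<ge> N" for n
  proof -
    have "(2 * ?K)-lipschitz_on UNIV (q n)"
    proof (rule lipschitz_onI)
      show "dist (q n u) (q n v) \<le> 2 * ?K * dist u v" for u v
        using q_lip[OF n, of u v] q_lip[OF n, of v u]
        by (simp add: dist_norm norm_minus_commute abs_le_iff)
    qed (use M_ge_1 in auto)
    then show ?thesis by (rule lipschitz_on_continuous_on)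
  qed
  have q_lim: "(\<lambda>i. q (i + N) v) \<longlonglongrightarrow> 0" for v
  proof (rule tendstoI)
    fix e :: real assume e: "e > 0"
    have "\<forall>\<^sub>F n in sequentially. \<forall>\<tau>\<in>{0..T}. dist (Sn n \<tau> v) (S \<tau> v) < e / 2"
      by (rule uniform_limitD[OF yosida_semigroups_converge[OF gen Sn N]]) (use e in simp_all)
    then have "\<forall>\<^sub>F i in sequentially. \<forall>\<tau>\<in>{0..T}. dist (Sn (i + N) \<tau> v) (S \<tau> v) < e / 2"
      by (rule sequentially_offset)
    then show "\<forall>\<^sub>F i in sequentially. dist (q (i + N) v) 0 < e"
    proof eventually_elim
      case (elim i)
      have "q (i + N) v \<le> e / 2"
        by (rule q_le) (use elim in \<open>auto simp: dist_norm intro: less_imp_le\<close>)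
      then show ?case using e q0[of "i + N" v] by simp
    qed
  qed
  have [measurable]: "f \<in> borel_measurable (lebesgue_on {0..T})" using f by simp
  have q_meas: "(\<lambda>s. q n (f s)) \<in> borel_measurable (lebesgue_on {0..T})" if "n \<ge> N" for n
    by (rule borel_measurable_continuous_on[OF q_cont[OF that]]) simp
  have q_bound: "norm (q n v) \<le> 2 * ?K * norm v" if "n \<ge> N" for n v
    using q_le[OF bound[OF that]] q0[OF that, of v] by auto
  have dom: "integrable (lebesgue_on {0..T}) (\<lambda>s. 2 * ?K * norm (f s))" using f by auto
  have q_int: "integrable (lebesgue_on {0..T}) (\<lambda>s. q n (f s))" if "n \<ge> N" for n
  proof (rule Bochner_Integration.integrable_bound[OF dom q_meas[OF that]])
    show "AE s in lebesgue_on {0..T}. norm (q n (f s)) \<le> norm (2 * ?K * norm (f s))"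
      using q_bound[OF that] by (intro AE_I2) (metis abs_ge_self order_trans real_norm_def)
  qed
  define \<epsilon> where "\<epsilon> n = (LINT s|lebesgue_on {0..T}. q n (f s))" for n
  have "(\<lambda>i. LINT s|lebesgue_on {0..T}. q (i + N) (f s)) \<longlonglongrightarrow> (LINT s|lebesgue_on {0..T}. 0)"
    by (rule integral_dominated_convergence[OF _ q_meas dom])
       (use q_lim q_bound in auto)
  then have "(\<lambda>i. \<epsilon> (i + N)) \<longlonglongrightarrow> 0" by (simp add: \<epsilon>_def)
  then have "\<epsilon> \<longlonglongrightarrow> 0" by (rule LIMSEQ_offset)
  moreover have "norm (LINT s|lebesgue_on {0..t}. Sn n (t - s) (f s) - S (t - s) (f s)) \<le> \<epsilon> n"
    if n: "n \<ge> N" and t: "t \<in> {0..T}" for n t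
  proof -
    have "norm (LINT s|lebesgue_on {0..t}. Sn n (t - s) (f s) - S (t - s) (f s))
        \<le> (LINT s|lebesgue_on {0..t}. norm (Sn n (t - s) (f s) - S (t - s) (f s)))"
      by (rule integral_norm_bound)
    also have "\<dots> \<le> \<epsilon> n"
      unfolding \<epsilon>_def
    proof (rule integral_mono_lebesgue_on_AE[OF q_int[OF n]])
      show "AE s in lebesgue_on {0..t}. norm (Sn n (t - s) (f s) - S (t - s) (f s)) \<le> q n (f s)"
        using t by (intro AE_I2 le_q n) auto
    qed (use t q0[OF n] in auto)
    finally show ?thesis .
  qed
  ultimately show ?thesis by blast
qed

end

lemma c0_semigroup_convolution:
  fixes S :: "real \<Rightarrow> 'a::{banach, second_countable_topology} \<Rightarrow>\<^sub>L 'a"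
  assumes S: "c0_semigroup S" and f: "integrable (lebesgue_on {0..T}) f"
  shows "t \<le> T \<Longrightarrow> integrable (lebesgue_on {0..t}) (\<lambda>s. S (t - s) (f s))"
    and "continuous_on {0..T} (\<lambda>t. LINT s|lebesgue_on {0..t}. S (t - s) (f s))"
    and "continuous_on {0..} (\<lambda>t. S t x)"
proof -
  obtain M \<omega> where M: "M \<ge> 1" "\<omega> \<ge> 0" "\<And>t. t \<ge> 0 \<Longrightarrow> norm (S t) \<le> M * exp (\<omega> * t)"
    using c0_semigroup_exponential_bound[OF S] by blast
  interpret exp_bounded_semigroup S M \<omega> by unfold_locales (use S M in auto)
  show "t \<le> T \<Longrightarrow> integrable (lebesgue_on {0..t}) (\<lambda>s. S (t - s) (f s))"
    and "continuous_on {0..T} (\<lambda>t. LINT s|lebesgue_on {0..t}. S (t - s) (f s))"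
    and "continuous_on {0..} (\<lambda>t. S t x)"
    by (rule integrable_convolution[OF f] continuous_on_convolution[OF f] continuous_on_orbit; assumption)+
qed


section \<open>Perturbation of mild solutions\<close>

text \<open>At a maximum point \<open>t0\<close> of \<open>\<phi> s / exp (2 c (s - a))\<close> the integral term contributes at most half
  of \<open>\<phi> t0\<close>, since the weight grows at twice the rate \<open>c\<close>, and can be absorbed.\<close>

lemma weighted_gronwall:
  fixes \<phi> :: "real \<Rightarrow> real"
  assumes cont: "continuous_on {a..T} \<phi>" and c: "c > 0" and \<alpha>: "\<alpha> \<ge> 0"
    and nonneg: "\<And>t. t \<in> {a..T} \<Longrightarrow> \<phi> t \<ge> 0"
    and le: "\<And>t. t \<in> {a..T} \<Longrightarrow> \<phi> t \<le> \<alpha> + c * (LINT s|lebesgue_on {a..t}. \<phi> s)"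
    and t: "t \<in> {a..T}"
  shows "\<phi> t \<le> 2 * \<alpha> * exp (2 * c * (t - a))"
proof -
  let ?e = "\<lambda>s. exp (2 * c * (s - a))"
  let ?\<psi> = "\<lambda>s. \<phi> s / ?e s"
  have "continuous_on {a..T} ?\<psi>" by (intro continuous_intros cont) simp
  then have "\<exists>t0\<in>{a..T}. \<forall>s\<in>{a..T}. ?\<psi> s \<le> ?\<psi> t0"
    using t by (intro continuous_attains_sup) auto
  then obtain t0 where t0: "t0 \<in> {a..T}" "\<And>s. s \<in> {a..T} \<Longrightarrow> ?\<psi> s \<le> ?\<psi> t0" by blast
  define m where "m = ?\<psi> t0"
  have m0: "m \<ge> 0" using nonneg[OF t0(1)] by (simp add: m_def)
  have \<phi>m: "\<phi> s \<le> m * ?e s" if "s \<in> {a..T}" for s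
    using t0(2)[OF that] by (simp add: m_def divide_le_eq)
  have FTC: "(LINT s|lebesgue_on {a..t0}. m * ?e s) = m * (?e t0 - 1) / (2 * c)"
  proof -
    have "((\<lambda>s. m * ?e s) has_integral (m * ?e t0 / (2 * c) - m * ?e a / (2 * c))) {a..t0}"
      using t0(1) c by (intro fundamental_theorem_of_calculus)
        (auto intro!: derivative_eq_intros simp flip: has_real_derivative_iff_has_vector_derivative)
    then have "integral {a..t0} (\<lambda>s. m * ?e s) = m * ?e t0 / (2 * c) - m * ?e a / (2 * c)"
      by (rule integral_unique)
    also have "\<dots> = m * (?e t0 - 1) / (2 * c)" by (simp add: diff_divide_distrib right_diff_distrib)
    finally have "integral {a..t0} (\<lambda>s. m * ?e s) = m * (?e t0 - 1) / (2 * c)" .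
    moreover have "integrable (lebesgue_on {a..t0}) (\<lambda>s. m * ?e s)"
      by (intro integrable_continuous_lebesgue_on continuous_intros)
    ultimately show ?thesis by (subst lebesgue_integral_eq_integral) auto
  qed
  have "m * ?e t0 = \<phi> t0" by (simp add: m_def)
  also have "\<dots> \<le> \<alpha> + c * (LINT s|lebesgue_on {a..t0}. \<phi> s)" by (rule le[OF t0(1)])
  also have "(LINT s|lebesgue_on {a..t0}. \<phi> s) \<le> (LINT s|lebesgue_on {a..t0}. m * ?e s)"
  proof (rule Bochner_Integration.integral_mono)
    show "integrable (lebesgue_on {a..t0}) \<phi>"
      using t0(1) by (intro integrable_continuous_lebesgue_on continuous_on_subset[OF cont]) auto
    show "integrable (lebesgue_on {a..t0}) (\<lambda>s. m * ?e s)"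
      by (intro integrable_continuous_lebesgue_on continuous_intros)
  qed (use \<phi>m t0(1) in auto)
  also have "\<alpha> + c * (LINT s|lebesgue_on {a..t0}. m * ?e s) \<le> \<alpha> + m * ?e t0 / 2"
    using c m0 unfolding FTC by (simp add: field_simps)
  finally have 1: "m * ?e t0 \<le> 2 * \<alpha>" using c by simp
  have "m * 1 \<le> m * ?e t0" using t0(1) c m0 by (intro mult_left_mono) auto
  then have "m \<le> 2 * \<alpha>" using 1 by simp
  then have "m * ?e t \<le> 2 * \<alpha> * ?e t" by (intro mult_right_mono) auto
  then show ?thesis using \<phi>m[OF t] by linarith
qed

text \<open>The Cauchy-Schwarz inequality against the constant \<open>1\<close>, from the nonnegativity of the variance.\<close>

lemma integral_power2_le:
  fixes g :: "real \<Rightarrow> real"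
  assumes g: "integrable (lebesgue_on {0..t}) g" and g2: "integrable (lebesgue_on {0..t}) (\<lambda>s. (g s)\<^sup>2)"
    and t: "t > 0"
  shows "(LINT s|lebesgue_on {0..t}. g s)\<^sup>2 \<le> t * (LINT s|lebesgue_on {0..t}. (g s)\<^sup>2)"
proof -
  define m where "m = (LINT s|lebesgue_on {0..t}. g s) / t"
  have I: "(LINT s|lebesgue_on {0..t}. g s) = m * t" using t by (simp add: m_def)
  have "0 \<le> (LINT s|lebesgue_on {0..t}. (g s - m)\<^sup>2)"
    by (intro Bochner_Integration.integral_nonneg) auto
  also have "\<dots> = (LINT s|lebesgue_on {0..t}. (g s)\<^sup>2 - (2 * m) * g s + m\<^sup>2)"
    by (simp add: power2_diff algebra_simps)
  also have "\<dots> = (LINT s|lebesgue_on {0..t}. (g s)\<^sup>2) - 2 * m * (m * t) + m\<^sup>2 * t"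
    using g g2 t I by (simp add: measure_restrict_space)
  finally have "m * m * t \<le> (LINT s|lebesgue_on {0..t}. (g s)\<^sup>2)"
    by (simp add: power2_eq_square algebra_simps)
  then have "t * (m * m * t) \<le> t * (LINT s|lebesgue_on {0..t}. (g s)\<^sup>2)"
    using t by (intro mult_left_mono) auto
  then show ?thesis unfolding I by (simp add: power2_eq_square mult_ac)
qed

text \<open>The integral equation extends to \<open>t = 0\<close>, where the integral is over a null set.\<close>

lemma mild_solution_formula:
  assumes y: "mild_solution r S E x x1 y" and S: "c0_semigroup S" and t: "0 \<le> t" "t \<le> T"
  shows "y t = S t x + (LINT s|lebesgue_on {0..t}. S (t - s) (E T y s))"
proof (cases "t = 0")
  case True
  have "(LINT s|lebesgue_on {0..0}. S (0 - s) (E T y s)) = 0"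
    by (simp add: integral_restrict_space)
       (rule integral_eq_zero_AE, use AE_completion[OF AE_lborel_singleton[of 0]] in auto)
  then show ?thesis using y by (simp add: True mild_solution_def c0_semigroup_zero[OF S])
next
  case False
  then have "t \<in> {0<..T}" "T \<ge> 0" using t by auto
  then show ?thesis using y unfolding mild_solution_def by blast
qed

text \<open>The difference \<open>y' - y\<close> equals the defect, which is bounded by \<open>\<eta>\<close>, plus the convolution of \<open>S'\<close>
  with \<open>E T (y' - y)\<close>. Squaring and using that \<open>E T\<close> up to time \<open>t\<close> is controlled by the past of
  its argument gives a Gronwall inequality for \<open>(norm (y' t - y t))\<^sup>2\<close>.\<close>

lemma mild_solution_perturbation:
  fixes F :: "(real \<Rightarrow> 'a::{real_inner, banach, second_countable_topology}) \<Rightarrow> 'a"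
  assumes E: "delay_extension r T F (E T)" and F: "W12_bounded_linear (-r) 0 F"
    and r: "r > 0" and T: "T > 0"
    and M: "M > 0" "\<And>y. L2_on (-r) T y \<Longrightarrow> (LINT s|lebesgue_on {0..T}. (norm (E T y s))\<^sup>2)
          \<le> M * (LINT s|lebesgue_on {-r..T}. (norm (y s))\<^sup>2)"
    and S: "c0_semigroup S" and S': "c0_semigroup S'"
    and K: "K > 0" "\<And>t v. t \<in> {0..T} \<Longrightarrow> norm (S' t v) \<le> K * norm v"
    and y: "mild_solution r S E x (\<lambda>_. 0) y" "\<And>s. s < 0 \<Longrightarrow> y s = 0"
    and y': "mild_solution r S' E x (\<lambda>_. 0) y'" "\<And>s. s < 0 \<Longrightarrow> y' s = 0"
    and \<eta>: "\<And>t. t \<in> {0..T} \<Longrightarrow> norm (S' t x - S t x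
        + (LINT s|lebesgue_on {0..t}. S' (t - s) (E T y s) - S (t - s) (E T y s))) \<le> \<eta>"
    and t: "t \<in> {0..T}"
  shows "(norm (y' t - y t))\<^sup>2 \<le> 4 * \<eta>\<^sup>2 * exp (4 * K\<^sup>2 * T * M * (T + r))"
proof -
  let ?f = "E T y" and ?f' = "E T y'"
  have L2: "L2_on (-r) T y" "L2_on (-r) T y'" using y y' T by (auto simp: mild_solution_def)
  have fL2: "L2_on 0 T ?f" "L2_on 0 T ?f'" using E L2 by (auto simp: delay_extension_def)
  have fi: "integrable (lebesgue_on {0..T}) ?f" "integrable (lebesgue_on {0..T}) ?f'"
    using fL2 by (auto intro: L2_on_imp_integrable)
  have yt: "y t = S t x + (LINT s|lebesgue_on {0..t}. S (t - s) (?f s))"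
    and yt': "y' t = S' t x + (LINT s|lebesgue_on {0..t}. S' (t - s) (?f' s))" if "t \<in> {0..T}" for t
    using mild_solution_formula[OF y(1) S] mild_solution_formula[OF y'(1) S'] that by auto
  have cont: "continuous_on {0..T} (\<lambda>t. y' t - y t)"
  proof -
    have "continuous_on {0..T} (\<lambda>t. (S' t x + (LINT s|lebesgue_on {0..t}. S' (t - s) (?f' s)))
        - (S t x + (LINT s|lebesgue_on {0..t}. S (t - s) (?f s))))"
      by (intro continuous_intros c0_semigroup_convolution(2)[OF S fi(1)] c0_semigroup_convolution(2)[OF S' fi(2)]
          continuous_on_subset[OF c0_semigroup_convolution(3)[OF S fi(1)]]
          continuous_on_subset[OF c0_semigroup_convolution(3)[OF S' fi(2)]]) auto
    then show ?thesis by (rule continuous_on_eq) (simp add: yt yt')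
  qed
  \<comment> \<open>Both solutions may jump at \<open>0\<close>, but their difference does not, since both start at \<open>x\<close>;
    freezing it outside \<open>[0,T]\<close> yields a continuous function on the whole line.\<close>
  define z where "z s = y' (max 0 (min s T)) - y (max 0 (min s T))" for s
  have zc: "continuous_on X z" for X
    unfolding z_def by (rule continuous_on_compose2[OF cont]) (use T in \<open>auto intro!: continuous_intros\<close>)
  have y0: "y 0 = x" "y' 0 = x" using y y' by (auto simp: mild_solution_def)
  have z: "z s = y' s - y s" if "s \<le> T" for s
    using that y0 y(2)[of s] y'(2)[of s] by (cases "s < 0") (auto simp: z_def max_def min_def)
  have zL2: "L2_on (-r) T z" by (rule L2_on_continuous[OF zc])
  have Ez: "AE s in lebesgue_on {0..T}. ?f' s - ?f s = E T z s"
  proof -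
    let ?d = "\<lambda>s. y' s - (z s + y s)"
    have d: "L2_on (-r) T ?d" and zy: "L2_on (-r) T (\<lambda>s. z s + y s)"
      by (intro L2_on_diff L2_on_add L2 zL2)+
    have "AE s in lebesgue_on {0..T}. E T ?d s = 0"
      by (rule delay_extension_zero[OF E]) (simp add: z)
    moreover have "AE s in lebesgue_on {0..T}. E T (\<lambda>s. ?d s + (z s + y s)) s = E T ?d s + E T (\<lambda>s. z s + y s) s"
      using E d zy unfolding delay_extension_def by blast
    moreover have "AE s in lebesgue_on {0..T}. E T (\<lambda>s. z s + y s) s = E T z s + E T y s"
      using E zL2 L2(1) unfolding delay_extension_def by blast
    ultimately show ?thesis by eventually_elim simp
  qed
  have EzL2: "L2_on 0 T (E T z)" using E zL2 by (auto simp: delay_extension_def)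
  have norm_z: "norm (z t) \<le> \<eta> + K * (LINT s|lebesgue_on {0..t}. norm (E T z s))" if t: "t \<in> {0..T}" for t
  proof -
    have tT: "t \<le> T" using t by simp
    note int = c0_semigroup_convolution(1)[OF S fi(1) tT] c0_semigroup_convolution(1)[OF S' fi(1) tT]
      c0_semigroup_convolution(1)[OF S' fi(2) tT]
    let ?R = "norm (LINT s|lebesgue_on {0..t}. S' (t - s) (?f' s) - S' (t - s) (?f s))"
    have eq: "z t = (S' t x - S t x + (LINT s|lebesgue_on {0..t}. S' (t - s) (?f s) - S (t - s) (?f s)))
        + (LINT s|lebesgue_on {0..t}. S' (t - s) (?f' s) - S' (t - s) (?f s))"
      unfolding z[OF tT] yt[OF t] yt'[OF t]
        Bochner_Integration.integral_diff[OF int(2,1)] Bochner_Integration.integral_diff[OF int(3,2)]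
      by simp
    have "norm (z t) \<le> \<eta> + ?R"
      unfolding eq by (rule order_trans[OF norm_triangle_ineq add_right_mono[OF \<eta>[OF t]]])
    moreover have "?R \<le> (LINT s|lebesgue_on {0..t}. K * norm (E T z s))"
    proof -
      have "?R \<le> (LINT s|lebesgue_on {0..t}. norm (S' (t - s) (?f' s) - S' (t - s) (?f s)))"
        by (rule integral_norm_bound)
      also have "\<dots> \<le> (LINT s|lebesgue_on {0..t}. K * norm (E T z s))"
      proof (rule integral_mono_lebesgue_on_AE)
        have "integrable (lebesgue_on {0..t}) (\<lambda>s. norm (E T z s))"
          using integrable_lebesgue_on_subinterval[OF L2_on_imp_integrable[OF EzL2], of 0 t] t by simp
        then show "integrable (lebesgue_on {0..t}) (\<lambda>s. K * norm (E T z s))" by simp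
        show "AE s in lebesgue_on {0..t}. norm (S' (t - s) (?f' s) - S' (t - s) (?f s)) \<le> K * norm (E T z s)"
          using Ez unfolding AE_lebesgue_on_iff
        proof eventually_elim
          case (elim s)
          show ?case
          proof
            assume s: "s \<in> {0..t}"
            then have "S' (t - s) (?f' s) - S' (t - s) (?f s) = S' (t - s) (E T z s)"
              using elim t by (simp flip: blinfun.diff_right)
            then show "norm (S' (t - s) (?f' s) - S' (t - s) (?f s)) \<le> K * norm (E T z s)"
              using K(2)[of "t - s" "E T z s"] s t by simp
          qed
        qed
      qed (use K(1) in auto)
      finally show ?thesis .
    qed
    ultimately show ?thesis by simp
  qed
  let ?c = "2 * K\<^sup>2 * T * M"
  have main: "(norm (z t))\<^sup>2 \<le> 2 * \<eta>\<^sup>2 + ?c * (LINT s|lebesgue_on {-r..t}. (norm (z s))\<^sup>2)"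
    if t: "t \<in> {-r..T}" for t
  proof (cases "t > 0")
    case False
    then have "z t = 0" using y0 T by (simp add: z_def)
    then show ?thesis using K M T
      by (simp add: Bochner_Integration.integral_nonneg)
  next
    case True
    then have t: "t \<in> {0..T}" using t by auto
    let ?I = "LINT s|lebesgue_on {0..t}. norm (E T z s)"
    have Ii: "integrable (lebesgue_on {0..t}) (\<lambda>s. norm (E T z s))"
      using integrable_lebesgue_on_subinterval[OF L2_on_imp_integrable[OF EzL2], of 0 t] t by simp
    have Ii2: "integrable (lebesgue_on {0..t}) (\<lambda>s. (norm (E T z s))\<^sup>2)"
      by (rule integrable_lebesgue_on_subinterval[of 0 T]) (use EzL2 t in \<open>simp_all add: L2_on_def\<close>)
    have I2: "?I\<^sup>2 \<le> T * (M * (LINT s|lebesgue_on {-r..t}. (norm (z s))\<^sup>2))"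
    proof -
      have "?I\<^sup>2 \<le> t * (LINT s|lebesgue_on {0..t}. (norm (E T z s))\<^sup>2)"
        by (rule integral_power2_le[OF Ii Ii2 True])
      also have "\<dots> \<le> T * (LINT s|lebesgue_on {0..t}. (norm (E T z s))\<^sup>2)"
        using t by (intro mult_right_mono Bochner_Integration.integral_nonneg) auto
      also have "\<dots> \<le> T * (M * (LINT s|lebesgue_on {-r..t}. (norm (z s))\<^sup>2))"
        using t T delay_extension_integral_le_past[OF E F r _ _ M(2) zc, of t]
        by (intro mult_left_mono) auto
      finally show ?thesis .
    qed
    have "(norm (z t))\<^sup>2 \<le> (\<eta> + K * ?I)\<^sup>2" by (intro power_mono norm_z t) auto
    also have "\<dots> \<le> 2 * \<eta>\<^sup>2 + 2 * (K * ?I)\<^sup>2"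
      using zero_le_power2[of "\<eta> - K * ?I"] by (simp add: power2_diff power2_sum)
    also have "\<dots> = 2 * \<eta>\<^sup>2 + 2 * K\<^sup>2 * ?I\<^sup>2" by (simp add: power_mult_distrib)
    also have "\<dots> \<le> 2 * \<eta>\<^sup>2 + 2 * K\<^sup>2 * (T * (M * (LINT s|lebesgue_on {-r..t}. (norm (z s))\<^sup>2)))"
      by (intro add_left_mono mult_left_mono I2) auto
    finally show ?thesis by (simp add: mult_ac)
  qed
  have "(norm (z t))\<^sup>2 \<le> 2 * (2 * \<eta>\<^sup>2) * exp (2 * ?c * (t - - r))"
  proof (rule weighted_gronwall[OF _ _ _ _ main])
    show "continuous_on {-r..T} (\<lambda>s. (norm (z s))\<^sup>2)" by (intro continuous_intros zc)
  qed (use K M T t r in auto)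
  also have "\<dots> \<le> 2 * (2 * \<eta>\<^sup>2) * exp (2 * ?c * (T + r))"
  proof -
    have "2 * ?c * (t - - r) \<le> 2 * ?c * (T + r)" using K M T t by (intro mult_left_mono) auto
    then show ?thesis by (intro mult_left_mono) auto
  qed
  finally show ?thesis using t z[of t] by (simp add: mult_ac)
qed


section \<open>Convergence of the fundamental solutions\<close>

theorem proposition4p2:
  fixes D :: "'a::{real_inner, banach, second_countable_topology} set"
    and A :: "'a \<Rightarrow> 'a"
    and r :: real
    and F :: "(real \<Rightarrow> 'a) \<Rightarrow> 'a"
    and E :: "real \<Rightarrow> (real \<Rightarrow> 'a) \<Rightarrow> real \<Rightarrow> 'a"
    and G :: "real \<Rightarrow> 'a \<Rightarrow>\<^sub>L 'a"
    and Gn :: "nat \<Rightarrow> real \<Rightarrow> 'a \<Rightarrow>\<^sub>L 'a"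
    and x :: 'a
    and a b :: real
  assumes "r > 0"
    and "\<exists>S. generates D A S"
    and "W12_bounded_linear (-r) 0 F"
    and "\<And>T. T \<ge> 0 \<Longrightarrow> delay_extension r T F (E T)"
    and "fundamental_solution r D A E G"
    and "\<And>n. real n \<in> resolvent_set D A \<Longrightarrow>
           fundamental_solution r UNIV (blinfun_apply (yosida D A n)) E (Gn n)"
    and "0 \<le> a"
  shows "uniform_limit {a..b} (\<lambda>n t. Gn n t x) (\<lambda>t. G t x) sequentially"
proof (rule uniform_limitI)
  fix e :: real assume e: "e > 0"
  obtain S where gen: "generates D A S" and G: "\<And>x. mild_solution r S E x (\<lambda>_. 0) (\<lambda>t. G t x)"
    and G0: "\<And>t. t < 0 \<Longrightarrow> G t = 0"
    using assms(5) by (auto simp: fundamental_solution_def)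
  have c0: "c0_semigroup S" using gen by (simp add: generates_def)
  obtain M \<omega> where M: "M \<ge> 1" "\<omega> \<ge> 0" "\<And>t. t \<ge> 0 \<Longrightarrow> norm (S t) \<le> M * exp (\<omega> * t)"
    using c0_semigroup_exponential_bound[OF c0] by blast
  interpret exp_bounded_semigroup S M \<omega> by unfold_locales (use c0 M in auto)
  \<comment> \<open>Beyond \<open>2 * \<omega>\<close> the integers lie in the resolvent set and the bounds on the Yosida semigroups
    do not depend on \<open>n\<close>.\<close>
  define N where "N = nat \<lceil>2 * \<omega>\<rceil> + 1"
  have N: "real N \<ge> 2 * \<omega>" "N > 0" unfolding N_def by linarith+
  have fund: "fundamental_solution r UNIV (blinfun_apply (yosida D A n)) E (Gn n)" if "n \<ge> N" for n
  proof -
    have "real n > \<omega>" using that N M(2) by simp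
    then show ?thesis by (intro assms(6) resolvent_eq_laplace(1)[OF gen])
  qed
  then have "\<forall>n. \<exists>S'. n \<ge> N \<longrightarrow> generates UNIV (blinfun_apply (yosida D A n)) S' \<and>
      (\<forall>x. mild_solution r S' E x (\<lambda>_. 0) (\<lambda>t. Gn n t x))"
    unfolding fundamental_solution_def by blast
  then obtain Sn where Sn: "\<And>n. n \<ge> N \<Longrightarrow> generates UNIV (blinfun_apply (yosida D A n)) (Sn n)"
    and Gn: "\<And>n x. n \<ge> N \<Longrightarrow> mild_solution r (Sn n) E x (\<lambda>_. 0) (\<lambda>t. Gn n t x)"
    by metis
  have Gn0: "Gn n t = 0" if "n \<ge> N" "t < 0" for n t
    using fund[OF that(1)] that(2) by (simp add: fundamental_solution_def)
  define T where "T = max b 1"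
  have T: "T > 0" by (simp add: T_def)
  have E: "delay_extension r T F (E T)" using assms(4) T by simp
  obtain C where C: "C > 0" "\<And>y. L2_on (-r) T y \<Longrightarrow> (LINT s|lebesgue_on {0..T}. (norm (E T y s))\<^sup>2)
          \<le> C * (LINT s|lebesgue_on {-r..T}. (norm (y s))\<^sup>2)"
    using E unfolding delay_extension_def by blast
  let ?f = "E T (\<lambda>t. G t x)"
  have "L2_on (-r) T (\<lambda>t. G t x)" using G[of x] T by (auto simp: mild_solution_def)
  then have f: "integrable (lebesgue_on {0..T}) ?f"
    using E by (intro L2_on_imp_integrable) (auto simp: delay_extension_def)
  obtain \<epsilon> where \<epsilon>: "\<epsilon> \<longlonglongrightarrow> 0" "\<And>n t. n \<ge> N \<Longrightarrow> t \<in> {0..T} \<Longrightarrow>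
      norm (LINT s|lebesgue_on {0..t}. Sn n (t - s) (?f s) - S (t - s) (?f s)) \<le> \<epsilon> n"
    using yosida_convolutions_converge[OF gen Sn N less_imp_le[OF T] f] by blast
  let ?K = "M * exp (2 * \<omega> * T)"
  let ?X = "exp (4 * ?K\<^sup>2 * T * C * (T + r))"
  \<comment> \<open>The defect must be so small that the Gronwall factor still leaves less than \<open>e\<close>.\<close>
  define \<eta> where "\<eta> = e / (4 * sqrt ?X)"
  have \<eta>: "\<eta> > 0" using e by (simp add: \<eta>_def)
  have "\<eta>\<^sup>2 = e\<^sup>2 / (16 * ?X)" by (simp add: \<eta>_def power_divide power_mult_distrib)
  then have \<eta>e: "4 * \<eta>\<^sup>2 * ?X < e\<^sup>2" using e by simp
  have "\<forall>\<^sub>F n in sequentially. \<forall>t\<in>{0..T}. dist (Sn n t x) (S t x) < \<eta> / 2"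
    by (rule uniform_limitD[OF yosida_semigroups_converge[OF gen Sn N]]) (use \<eta> in simp_all)
  moreover have "\<forall>\<^sub>F n in sequentially. \<epsilon> n < \<eta> / 2"
    using \<epsilon>(1) \<eta> by (intro order_tendstoD(2)[where y = 0]) auto
  ultimately show "\<forall>\<^sub>F n in sequentially. \<forall>t\<in>{a..b}. dist (Gn n t x) (G t x) < e"
    using eventually_ge_at_top[of N]
  proof eventually_elim
    case (elim n)
    have nN: "n \<ge> N" by (rule elim)
    have nn: "real n \<ge> 2 * \<omega>" "n > 0" using nN N by auto
    have c0n: "c0_semigroup (Sn n)" using Sn[OF nN] by (simp add: generates_def)
    show ?case
    proof
      fix t assume "t \<in> {a..b}"
      then have t: "t \<in> {0..T}" using assms(7) by (auto simp: T_def)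
      have "(norm (Gn n t x - G t x))\<^sup>2 \<le> 4 * \<eta>\<^sup>2 * ?X"
      proof (rule mild_solution_perturbation[OF E assms(3,1) T C c0 c0n _ _ G _ Gn[OF nN] _ _ t])
        show "?K > 0" using M(1) by simp
        show "norm (Sn n s v) \<le> ?K * norm v" if s: "s \<in> {0..T}" for s v
        proof (rule order_trans[OF yosida_semigroup_bound[OF gen nn Sn[OF nN]]])
          have "2 * \<omega> * s \<le> 2 * \<omega> * T" using s M(2) by (intro mult_left_mono) auto
          then show "M * exp (2 * \<omega> * s) * norm v \<le> ?K * norm v"
            using M(1) by (intro mult_right_mono mult_left_mono) auto
        qed (use s in auto)
        show "norm (Sn n s x - S s x + (LINT u|lebesgue_on {0..s}. Sn n (s - u) (?f u) - S (s - u) (?f u))) \<le> \<eta>"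
          if s: "s \<in> {0..T}" for s
        proof -
          have "norm (Sn n s x - S s x) \<le> \<eta> / 2"
            using elim(1) s by (auto simp: dist_norm intro: less_imp_le)
          moreover have "norm (LINT u|lebesgue_on {0..s}. Sn n (s - u) (?f u) - S (s - u) (?f u)) \<le> \<eta> / 2"
            using \<epsilon>(2)[OF nN s] elim(2) by linarith
          ultimately show ?thesis
            using norm_triangle_ineq[of "Sn n s x - S s x"
                "LINT u|lebesgue_on {0..s}. Sn n (s - u) (?f u) - S (s - u) (?f u)"] by linarith
        qed
      qed (simp_all add: G0 Gn0[OF nN])
      also note \<eta>e
      finally have "norm (Gn n t x - G t x) < e" by (rule power_less_imp_less_base) (use e in simp)
      then show "dist (Gn n t x) (G t x) < e" by (simp add: dist_norm)
    qed
  qed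
qed

end
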